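(* Let $m\in\mathbb N$. The truncated semigroup $\mathcal G_m(\cdot)$ on $X_m=\mathbb R^{2m+1}$ generated by $$\frac{du^m}{dt}=\nu\Lambda_mu^m-\alpha u^mD_m^-u^m+\beta u^m(1-u^m)(u^m-\gamma)-\lambda u^m+f^m$$ has a global attractor $\mathcal A_m$ in $X_m$, and the random attractors $\mathcal A_m^\epsilon(\omega)$, $\epsilon\in(0,\epsilon^*]$, of the truncated random dynamical systems $\Xi_m^\epsilon$ satisfy $$\lim_{\epsilon\to0}\mathrm{dist}_{X_m}(\mathcal A_m^\epsilon(\omega),\mathcal A_m)=0\qquad\forall\omega\in\Omega.$$
   Context: Parameters: $\alpha,\beta,\nu,\lambda>0$, $\gamma\in(0,1)$, $f=(f_i)_{i\in\mathbb Z}\in\ell^2$ with norm $\|f\|$. Constants: $\lambda^*=4\nu+\frac{(2\alpha+\beta+\beta\gamma)^2}{4\beta}-\beta\gamma$, standing assumption $\lambda>\lambda^*$; $M_r=\beta r^3+(2\alpha+\beta+\beta\gamma)r^2+(4\nu+\beta\gamma+\lambda)r+\|f\|$, $L_r=4\nu+2\sqrt5\,r\alpha+\sqrt{12r^2(1+\gamma)^2+27r^4+3\gamma^2}\,\beta+\lambda$; $r^*=1+\frac{\|f\|}{\lambda-\lambda^*}$; $\epsilon^*=\min\left(\frac1{M_{r^*+1}},\frac1{1+L_{r^*+1}}\right)$. $X_m=\mathbb R^{2m+1}$ has coordinates indexed by $|i|\le m$ and Euclidean norm. $D_m^-$ is the matrix with $-1$ on the diagonal, $1$ on the first subdiagonal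 and $0$ elsewhere; $\Lambda_m=(D_m^-)^{\top}D_m^-$ is tridiagonal with off-diagonal entries $-1$ and diagonal $2,\dots,2,1$; $f^m=(f_i)_{|i|\le m}$. Products and powers of vectors are componentwise. $\mathcal G_m(t)u_0^m=u^m(t,u_0^m)$ is the solution at time $t\ge0$ of the deterministic equation with initial value $u_0^m$. A global attractor of $\mathcal G_m$ is a compact invariant set attracting all bounded subsets of $X_m$ in the Hausdorff semi-distance $\mathrm{dist}_{X_m}(A,B)=\sup_{a\in A}\inf_{b\in B}|a-b|$. $\Omega=\{\omega\in C(\mathbb R,\mathbb R):\omega(0)=0\}$ with the Borel $\sigma$-algebra of the compact-open topology, two-sided Wiener measure $\mathbb P$, shifts $\theta_t\omega(\cdot)=\omega(t+\cdot)-\omega(t)$; $z(\theta_t\omega)=-\int_{-\infty}^0e^s(\theta_t\omega)(s)\,ds$. $\Omega$ is replaced (keeping the notation) by a $\theta_t$-invariant full-measure subset on which $t\mapsto z(\theta_t\omega)$ is continuous, $\lim_{t\to\pm\infty}|z(\theta_t\omega)|/|t|=0$ and $\lim_{t\to\pm\infty}\frac1t\int_0^tz(\theta_s\omega)ds=0$. $\Xi_m^\epsilon(t,\omega)$ is the solution cocycle on $X_m$ of $\frac{dU}{dt}=\nu\Lambda_mU-\alpha e^{\epsilon z(\theta_t\omega)}UD_m^-U-\beta e^{2\epsilon z(\theta_t\omega)}U^3+\beta(1+\gamma)e^{\epsilon z(\theta_t\omega)}U^2-(\beta\gamma+\lambda)U+e^{-\epsilon z(\theta_t\omega)}f^m+\epsilon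 z(\theta_t\omega)U$. $\tilde{\mathcal D}_m$ is the universe of tempered random sets in $X_m$: $\lim_{t\to+\infty}e^{-\rho t}\sup\{|x|:x\in\mathcal D(\theta_{-t}\omega)\}=0$ for all $\rho>0$, $\omega\in\Omega$. $\mathcal A_m^\epsilon=\{\mathcal A_m^\epsilon(\omega)\}\in\tilde{\mathcal D}_m$ is the random attractor of $\Xi_m^\epsilon$: a random compact set with $\Xi_m^\epsilon(t,\omega)\mathcal A_m^\epsilon(\omega)=\mathcal A_m^\epsilon(\theta_t\omega)$ for $t\ge0$ and $\lim_{t\to\infty}\mathrm{dist}_{X_m}(\Xi_m^\epsilon(t,\theta_{-t}\omega)\mathcal D(\theta_{-t}\omega),\mathcal A_m^\epsilon(\omega))=0$ for all $\mathcal D\in\tilde{\mathcal D}_m$, $\omega\in\Omega$. *)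

theory Defs
  imports "HOL-Probability.Probability"
begin

text \<open>The semi-distance takes values in \<^typ>\<open>ennreal\<close>, so that the supremum and the infimum need
  no side conditions: the infimum over the empty set is infinite.\<close>

definition semidist :: "'a::metric_space set \<Rightarrow> 'a set \<Rightarrow> ennreal" where
  "semidist A B = (SUP a\<in>A. INF b\<in>B. ennreal (dist a b))"

definition solves_ivp :: "(real \<Rightarrow> 'a \<Rightarrow> 'a) \<Rightarrow> 'a::real_normed_vector \<Rightarrow> (real \<Rightarrow> 'a) \<Rightarrow> bool" where
  "solves_ivp F x0 u \<longleftrightarrow>
     u 0 = x0 \<and> (\<forall>t\<ge>0. (u has_vector_derivative F t (u t)) (at t within {0..}))"

text \<open>The description is of the value at time \<open>t\<close>, because a solution is determined
  on \<open>{0..}\<close> only.\<close>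

definition solution_at :: "(real \<Rightarrow> 'a \<Rightarrow> 'a) \<Rightarrow> real \<Rightarrow> 'a::real_normed_vector \<Rightarrow> 'a" where
  "solution_at F t x0 = (THE x. \<exists>u. solves_ivp F x0 u \<and> u t = x)"

definition global_attractor :: "(real \<Rightarrow> 'a \<Rightarrow> 'a) \<Rightarrow> 'a::metric_space set \<Rightarrow> bool" where
  "global_attractor S A \<longleftrightarrow>
     compact A \<and>
     (\<forall>t\<ge>0. S t ` A = A) \<and>
     (\<forall>B. bounded B \<longrightarrow> ((\<lambda>t. semidist (S t ` B) A) \<longlongrightarrow> 0) at_top)"

definition path_space :: "(real \<Rightarrow> real) set" where
  "path_space = {\<omega>. continuous_on UNIV \<omega> \<and> \<omega> 0 = 0}"

definition compact_open_paths :: "(real \<Rightarrow> real) topology" where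
  "compact_open_paths =
     topology_generated_by {{\<omega> \<in> path_space. \<omega> ` K \<subseteq> V} | K V. compact K \<and> open V}"

definition borel_paths :: "(real \<Rightarrow> real) measure" where
  "borel_paths = sigma path_space {V. openin compact_open_paths V}"

text \<open>Two-sided Wiener measure: the coordinate process has independent centred Gaussian increments
  of variance \<open>t - s\<close> over the whole real line; it starts at \<open>0\<close> and is continuous by the choice
  of the path space.\<close>

definition two_sided_wiener :: "(real \<Rightarrow> real) measure \<Rightarrow> bool" where
  "two_sided_wiener P \<longleftrightarrow>
     prob_space P \<and>
     space P = path_space \<and> sets P = sets borel_paths \<and>
     (\<forall>s t. s < t \<longrightarrow>
        distributed P lborel (\<lambda>\<omega>. \<omega> t - \<omega> s) (normal_density 0 (sqrt (t - s)))) \<and>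
     (\<forall>(\<tau> :: nat \<Rightarrow> real) n. mono \<tau> \<longrightarrow>
        prob_space.indep_vars P (\<lambda>_. borel) (\<lambda>k \<omega>. \<omega> (\<tau> (Suc k)) - \<omega> (\<tau> k)) {..<n})"

definition shift :: "real \<Rightarrow> (real \<Rightarrow> real) \<Rightarrow> real \<Rightarrow> real" where
  "shift t \<omega> = (\<lambda>s. \<omega> (t + s) - \<omega> t)"

text \<open>The gauge integral covers both absolutely and improperly convergent integrals
  over the half-line.\<close>

definition ou :: "(real \<Rightarrow> real) \<Rightarrow> real" where
  "ou \<omega> = - integral {..0} (\<lambda>s. exp s * \<omega> s)"

text \<open>The interval integral below is oriented, so it is the usual one also for \<open>t < 0\<close>.\<close>

definition admissible_paths :: "(real \<Rightarrow> real) measure \<Rightarrow> (real \<Rightarrow> real) set \<Rightarrow> bool" where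
  "admissible_paths P \<Omega> \<longleftrightarrow>
     \<Omega> \<subseteq> path_space \<and>
     (AE \<omega> in P. \<omega> \<in> \<Omega>) \<and>
     (\<forall>t. shift t ` \<Omega> = \<Omega>) \<and>
     (\<forall>\<omega>\<in>\<Omega>.
        continuous_on UNIV (\<lambda>t. ou (shift t \<omega>)) \<and>
        ((\<lambda>t. \<bar>ou (shift t \<omega>)\<bar> / \<bar>t\<bar>) \<longlongrightarrow> 0) at_top \<and>
        ((\<lambda>t. \<bar>ou (shift t \<omega>)\<bar> / \<bar>t\<bar>) \<longlongrightarrow> 0) at_bot \<and>
        ((\<lambda>t. 1 / t * (LBINT s=0..t. ou (shift s \<omega>))) \<longlongrightarrow> 0) at_top \<and>
        ((\<lambda>t. 1 / t * (LBINT s=0..t. ou (shift s \<omega>))) \<longlongrightarrow> 0) at_bot)"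

text \<open>Only the values of a family at points of \<open>\<Omega>\<close> are relevant; \<open>\<Omega>\<close> carries the trace of the
  sigma-algebra of \<open>P\<close>.  Random sets are nonempty, hence \<^const>\<open>infdist\<close> is the genuine distance.\<close>

definition random_set ::
  "(real \<Rightarrow> real) measure \<Rightarrow> (real \<Rightarrow> real) set \<Rightarrow> ((real \<Rightarrow> real) \<Rightarrow> 'a::metric_space set) \<Rightarrow> bool"
  where
  "random_set P \<Omega> D \<longleftrightarrow>
     (\<forall>\<omega>\<in>\<Omega>. D \<omega> \<noteq> {}) \<and>
     (\<forall>x. (\<lambda>\<omega>. infdist x (D \<omega>)) \<in> borel_measurable (restrict_space P \<Omega>))"

definition tempered_universe ::
  "(real \<Rightarrow> real) measure \<Rightarrow> (real \<Rightarrow> real) set \<Rightarrow>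
   ((real \<Rightarrow> real) \<Rightarrow> 'a::real_normed_vector set) set" where
  "tempered_universe P \<Omega> =
     {D. random_set P \<Omega> D \<and>
         (\<forall>\<rho>>0. \<forall>\<omega>\<in>\<Omega>.
            ((\<lambda>t. ennreal (exp (- \<rho> * t)) * (SUP x\<in>D (shift (- t) \<omega>). ennreal (norm x)))
               \<longlongrightarrow> 0) at_top)}"

definition random_attractor ::
  "(real \<Rightarrow> real) measure \<Rightarrow> (real \<Rightarrow> real) set \<Rightarrow> (real \<Rightarrow> (real \<Rightarrow> real) \<Rightarrow> 'a \<Rightarrow> 'a) \<Rightarrow>
   ((real \<Rightarrow> real) \<Rightarrow> 'a::real_normed_vector set) \<Rightarrow> bool" where
  "random_attractor P \<Omega> \<Phi> A \<longleftrightarrow>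
     A \<in> tempered_universe P \<Omega> \<and>
     (\<forall>\<omega>\<in>\<Omega>. compact (A \<omega>)) \<and>
     (\<forall>\<omega>\<in>\<Omega>. \<forall>t\<ge>0. \<Phi> t \<omega> ` A \<omega> = A (shift t \<omega>)) \<and>
     (\<forall>D\<in>tempered_universe P \<Omega>. \<forall>\<omega>\<in>\<Omega>.
        ((\<lambda>t. semidist (\<Phi> t (shift (- t) \<omega>) ` D (shift (- t) \<omega>)) (A \<omega>)) \<longlongrightarrow> 0) at_top)"

text \<open>A bijection \<open>ix\<close> from the finite index type onto \<open>{-m..m}\<close> labels the coordinates of
  \<open>real ^ 'n\<close>, i.e. of the Euclidean space of dimension \<open>2 m + 1\<close>.\<close>

definition Dminus :: "('n::finite \<Rightarrow> int) \<Rightarrow> real ^ 'n ^ 'n" where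
  "Dminus ix = (\<chi> i j. if ix i = ix j then - 1 else if ix i = ix j + 1 then 1 else 0)"

definition Lam :: "('n::finite \<Rightarrow> int) \<Rightarrow> real ^ 'n ^ 'n" where
  "Lam ix = transpose (Dminus ix) ** Dminus ix"

definition semigroup_field ::
  "real \<Rightarrow> real \<Rightarrow> real \<Rightarrow> real \<Rightarrow> real \<Rightarrow> (int \<Rightarrow> real) \<Rightarrow> ('n::finite \<Rightarrow> int) \<Rightarrow>
   real ^ 'n \<Rightarrow> real ^ 'n" where
  "semigroup_field \<alpha> \<beta> \<nu> lam \<gamma> f ix u =
     (\<chi> i. \<nu> * (Lam ix *v u) $ i
          - \<alpha> * u $ i * (Dminus ix *v u) $ i
          + \<beta> * u $ i * (1 - u $ i) * (u $ i - \<gamma>)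
          - lam * u $ i
          + f (ix i))"

definition lattice_semigroup ::
  "real \<Rightarrow> real \<Rightarrow> real \<Rightarrow> real \<Rightarrow> real \<Rightarrow> (int \<Rightarrow> real) \<Rightarrow> ('n::finite \<Rightarrow> int) \<Rightarrow>
   real \<Rightarrow> real ^ 'n \<Rightarrow> real ^ 'n" where
  "lattice_semigroup \<alpha> \<beta> \<nu> lam \<gamma> f ix =
     solution_at (\<lambda>t. semigroup_field \<alpha> \<beta> \<nu> lam \<gamma> f ix)"

text \<open>\<open>y\<close> stands for the value of \<open>\<epsilon> z(\<theta>\<^sub>t \<omega>)\<close>.\<close>

definition cocycle_field ::
  "real \<Rightarrow> real \<Rightarrow> real \<Rightarrow> real \<Rightarrow> real \<Rightarrow> (int \<Rightarrow> real) \<Rightarrow> ('n::finite \<Rightarrow> int) \<Rightarrow>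
   real \<Rightarrow> real ^ 'n \<Rightarrow> real ^ 'n" where
  "cocycle_field \<alpha> \<beta> \<nu> lam \<gamma> f ix y U =
     (\<chi> i. \<nu> * (Lam ix *v U) $ i
          - \<alpha> * exp y * U $ i * (Dminus ix *v U) $ i
          - \<beta> * exp (2 * y) * (U $ i) ^ 3
          + \<beta> * (1 + \<gamma>) * exp y * (U $ i) ^ 2
          - (\<beta> * \<gamma> + lam) * U $ i
          + exp (- y) * f (ix i)
          + y * U $ i)"

definition lattice_cocycle ::
  "real \<Rightarrow> real \<Rightarrow> real \<Rightarrow> real \<Rightarrow> real \<Rightarrow> (int \<Rightarrow> real) \<Rightarrow> ('n::finite \<Rightarrow> int) \<Rightarrow>
   real \<Rightarrow> real \<Rightarrow> (real \<Rightarrow> real) \<Rightarrow> real ^ 'n \<Rightarrow> real ^ 'n" where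
  "lattice_cocycle \<alpha> \<beta> \<nu> lam \<gamma> f ix \<epsilon> t \<omega> =
     solution_at (\<lambda>s. cocycle_field \<alpha> \<beta> \<nu> lam \<gamma> f ix (\<epsilon> * ou (shift s \<omega>))) t"

definition l2_norm :: "(int \<Rightarrow> real) \<Rightarrow> real" where
  "l2_norm f = sqrt (\<Sum>\<^sub>\<infinity>i. (f i)\<^sup>2)"

definition lam_star :: "real \<Rightarrow> real \<Rightarrow> real \<Rightarrow> real \<Rightarrow> real" where
  "lam_star \<alpha> \<beta> \<nu> \<gamma> = 4 * \<nu> + (2 * \<alpha> + \<beta> + \<beta> * \<gamma>)\<^sup>2 / (4 * \<beta>) - \<beta> * \<gamma>"

definition M_const ::
  "real \<Rightarrow> real \<Rightarrow> real \<Rightarrow> real \<Rightarrow> real \<Rightarrow> (int \<Rightarrow> real) \<Rightarrow> real \<Rightarrow> real" where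
  "M_const \<alpha> \<beta> \<nu> lam \<gamma> f r =
     \<beta> * r ^ 3 + (2 * \<alpha> + \<beta> + \<beta> * \<gamma>) * r\<^sup>2 + (4 * \<nu> + \<beta> * \<gamma> + lam) * r + l2_norm f"

definition L_const :: "real \<Rightarrow> real \<Rightarrow> real \<Rightarrow> real \<Rightarrow> real \<Rightarrow> real \<Rightarrow> real" where
  "L_const \<alpha> \<beta> \<nu> lam \<gamma> r =
     4 * \<nu> + 2 * sqrt 5 * r * \<alpha>
       + sqrt (12 * r\<^sup>2 * (1 + \<gamma>)\<^sup>2 + 27 * r ^ 4 + 3 * \<gamma>\<^sup>2) * \<beta> + lam"

definition r_star :: "real \<Rightarrow> real \<Rightarrow> real \<Rightarrow> real \<Rightarrow> real \<Rightarrow> (int \<Rightarrow> real) \<Rightarrow> real" where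
  "r_star \<alpha> \<beta> \<nu> lam \<gamma> f = 1 + l2_norm f / (lam - lam_star \<alpha> \<beta> \<nu> \<gamma>)"

definition eps_star :: "real \<Rightarrow> real \<Rightarrow> real \<Rightarrow> real \<Rightarrow> real \<Rightarrow> (int \<Rightarrow> real) \<Rightarrow> real" where
  "eps_star \<alpha> \<beta> \<nu> lam \<gamma> f =
     min (1 / M_const \<alpha> \<beta> \<nu> lam \<gamma> f (r_star \<alpha> \<beta> \<nu> lam \<gamma> f + 1))
         (1 / (1 + L_const \<alpha> \<beta> \<nu> lam \<gamma> (r_star \<alpha> \<beta> \<nu> lam \<gamma> f + 1)))"

end

theory Submission
  imports Defs "HOL-Real_Asymp.Real_Asymp"
begin

text \<open>Both equations are driven by the same field, at the parameter \<open>y = 0\<close> and at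
  \<open>y = \<epsilon> z(\<theta>\<^sub>t \<omega>)\<close> respectively. The cubic damping dominates the convection and the
  quadratic terms with something to spare, which yields
  \<open>d/dt |u|\<^sup>2 \<le> - gap |u|\<^sup>2 + energy exp (2 |y|)\<close> with constants that do not depend on \<open>y\<close>.
  For \<open>y = 0\<close> a ball is absorbing and positively invariant, and the intersection of its images is
  the global attractor. In the random case \<open>z\<close> grows sublinearly into the past, so pulling back
  along a tempered invariant family puts \<open>\<A>\<^sup>\<epsilon>(\<omega>)\<close> into the same ball once \<open>\<epsilon>\<close> is small,
  for every \<open>\<omega>\<close>. Since \<open>\<A>\<^sup>\<epsilon>(\<omega>)\<close> is the image of \<open>\<A>\<^sup>\<epsilon>(\<theta>\<^sub>-\<^sub>t \<omega>)\<close> under the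
  cocycle at time \<open>t\<close>, which tends to the semigroup at time \<open>t\<close> uniformly on the ball as
  \<open>\<epsilon> \<rightarrow> 0\<close>, attraction of the ball by the semigroup gives the claim.\<close>

text \<open>The obstacle is the term \<open>y * U\<close>, which has no sign: left in the linear
  part it would make the decay rate follow the noise. It has to be absorbed by quartic damping that
  survives after Young's inequality has dealt with the cubic terms, and the strict inequality
  \<open>lam > lam_star\<close> pays for that: half of the surplus is spent on keeping quartic
  damping, the other half is the decay rate. In the energy balance the cubic terms carry
  \<open>exp y\<close> and the quartic term \<open>exp (2 * y)\<close>, so Young's constants do not
  depend on \<open>y\<close>. The noise then only costs a factor \<open>exp (2 * |y|)\<close> on a
  constant, and this is integrable against the decay as soon as \<open>|y|\<close> grows into the
  past with a slope below half the decay rate. The threshold for \<epsilon> depends on the path, so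
  the order of choices matters: the accuracy fixes the time \<open>t\<close>, then the path shifted
  by \<open>- t\<close> is fixed, and only then is \<epsilon> made small for that path.\<close>

section \<open>Differential inequalities and initial value problems\<close>

text \<open>The product \<open>exp (- k * t) * w t\<close> is nonincreasing. Neither
  \<open>k\<close> nor \<open>w\<close> needs a sign: the applications use growth
  (\<open>k > 0\<close>), decay (\<open>k < 0\<close>) and plain monotonicity
  (\<open>k = 0\<close>).\<close>

lemma differential_gronwall:
  fixes w w' :: "real \<Rightarrow> real"
  assumes deriv: "\<And>t. t \<in> {0..T} \<Longrightarrow> (w has_vector_derivative w' t) (at t within {0..T})"
    and le: "\<And>t. t \<in> {0..T} \<Longrightarrow> w' t \<le> k * w t"
    and t: "t \<in> {0..T}"
  shows "w t \<le> exp (k * t) * w 0"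
proof -
  define g where "g s = exp (- k * s) * w s" for s
  have g: "(g has_real_derivative exp (- k * s) * (w' s - k * w s)) (at s within {0..T})"
    if "s \<in> {0..T}" for s
    unfolding g_def
    using deriv[OF that, folded has_real_derivative_iff_has_vector_derivative]
    by (auto intro!: derivative_eq_intros simp: algebra_simps)
  \<comment> \<open>At \<open>0\<close> and \<open>T\<close> the derivative is only one-sided, so
    monotonicity is drawn from the open interval together with continuity.\<close>
  have "g t \<le> g 0"
  proof (rule DERIV_nonpos_imp_decreasing_open[where f = g])
    fix s assume s: "0 < s" "s < t"
    then have "at s within {0..T} = at s"
      using t by (intro at_within_interior) auto
    then have "DERIV g s :> exp (- k * s) * (w' s - k * w s)"
      using g[of s] s t by simp
    moreover have "exp (- k * s) * (w' s - k * w s) \<le> 0"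
      using le[of s] s t by (simp add: mult_nonneg_nonpos)
    ultimately show "\<exists>y. DERIV g s :> y \<and> y \<le> 0"
      by blast
  next
    have "continuous_on {0..T} g"
      by (rule DERIV_continuous_on[OF g])
    then show "continuous_on {0..t} g"
      by (rule continuous_on_subset) (use t in auto)
  qed (use t in auto)
  then have "exp (k * t) * g t \<le> exp (k * t) * w 0"
    by (simp add: g_def)
  then show ?thesis
    by (simp add: g_def exp_minus field_simps)
qed

lemma has_vector_derivative_inner_self:
  fixes u :: "real \<Rightarrow> 'a::real_inner"
  assumes "(u has_vector_derivative u') (at t within S)"
  shows "((\<lambda>t. (norm (u t))\<^sup>2) has_vector_derivative 2 * (u t \<bullet> u')) (at t within S)"
proof -
  have "((\<lambda>t. u t \<bullet> u t) has_derivative (\<lambda>h. u t \<bullet> (h *\<^sub>R u') + (h *\<^sub>R u') \<bullet> u t)) (at t within S)"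
    using assms unfolding has_vector_derivative_def by (intro has_derivative_inner)
  then show ?thesis
    unfolding has_vector_derivative_def dot_square_norm
    by (simp add: inner_commute algebra_simps)
qed

text \<open>Squares are used because the norm is not differentiable at \<open>0\<close>. The defect
  \<eta> is absorbed by \<open>2 * a * b \<le> a^2 + b^2\<close>, whence the rate
  \<open>2 * L + 1\<close>. With \<open>\<eta> = 0\<close> this is uniqueness, otherwise dependence
  on data and field.\<close>

lemma gronwall_distance:
  fixes u v :: "real \<Rightarrow> 'a::real_inner"
  assumes u: "\<And>t. t \<in> {0..T} \<Longrightarrow> (u has_vector_derivative u' t) (at t within {0..T})"
    and v: "\<And>t. t \<in> {0..T} \<Longrightarrow> (v has_vector_derivative v' t) (at t within {0..T})"
    and le: "\<And>t. t \<in> {0..T} \<Longrightarrow> norm (u' t - v' t) \<le> L * norm (u t - v t) + \<eta>"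
    and "L \<ge> 0" and t: "t \<in> {0..T}"
  shows "(norm (u t - v t))\<^sup>2 \<le> exp ((2 * L + 1) * t) * ((norm (u 0 - v 0))\<^sup>2 + \<eta>\<^sup>2)"
proof -
  define w where "w s = (norm (u s - v s))\<^sup>2 + \<eta>\<^sup>2" for s
  have "w t \<le> exp ((2 * L + 1) * t) * w 0"
  proof (rule differential_gronwall[OF _ _ t])
    fix s assume s: "s \<in> {0..T}"
    show "(w has_vector_derivative 2 * ((u s - v s) \<bullet> (u' s - v' s))) (at s within {0..T})"
      unfolding w_def has_vector_derivative_add_const
      by (intro has_vector_derivative_inner_self has_vector_derivative_diff u v s)
    let ?d = "norm (u s - v s)"
    have "(u s - v s) \<bullet> (u' s - v' s) \<le> ?d * norm (u' s - v' s)"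
      by (rule norm_cauchy_schwarz)
    also have "\<dots> \<le> ?d * (L * ?d + \<eta>)"
      by (intro mult_left_mono le s) auto
    finally have "2 * ((u s - v s) \<bullet> (u' s - v' s)) \<le> 2 * L * ?d\<^sup>2 + 2 * ?d * \<eta>"
      by (simp add: algebra_simps power2_eq_square)
    also have "2 * ?d * \<eta> \<le> ?d\<^sup>2 + \<eta>\<^sup>2"
      by (rule sum_squares_bound)
    also have "2 * L * ?d\<^sup>2 + (?d\<^sup>2 + \<eta>\<^sup>2) \<le> (2 * L + 1) * w s"
      using \<open>L \<ge> 0\<close> by (simp add: w_def algebra_simps)
    finally show "2 * ((u s - v s) \<bullet> (u' s - v' s)) \<le> (2 * L + 1) * w s"
      by simp
  qed
  then show ?thesis
    using zero_le_power2[of \<eta>] unfolding w_def by linarith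
qed

text \<open>The weight \<open>exp (- K * t)\<close> makes the Picard operator a contraction on the whole of \<open>{0..T}\<close>.\<close>

lemma picard_globally_lipschitz:
  fixes G :: "real \<Rightarrow> 'a::euclidean_space \<Rightarrow> 'a"
  assumes "T \<ge> 0" and cont: "continuous_on ({0..T} \<times> UNIV) (\<lambda>(t, x). G t x)"
    and lip: "\<And>t x y. t \<in> {0..T} \<Longrightarrow> norm (G t x - G t y) \<le> L * norm (x - y)" and "L > 0"
  shows "\<exists>u. u 0 = x0 \<and> (\<forall>t\<in>{0..T}. (u has_vector_derivative G t (u t)) (at t within {0..T}))"
proof -
  \<comment> \<open>The contraction factor will be \<open>L / K = 1/2\<close>.\<close>
  define K where "K = 2 * L"
  have K: "K > 0" using \<open>L > 0\<close> by (simp add: K_def)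
  \<comment> \<open>Here \<open>v\<close> is the weighted unknown
    \<open>exp (- K * t) * u t\<close>, so the plain sup norm of \<open>v\<close> is the weighted
    norm of \<open>u\<close>.\<close>
  define I where "I v t = exp (- K * t) *\<^sub>R (x0 + integral {0..t} (\<lambda>s. G s (exp (K * s) *\<^sub>R v s)))"
    for v :: "real \<Rightarrow> 'a" and t
  have G_cont: "continuous_on {0..T} (\<lambda>s. G s (exp (K * s) *\<^sub>R v s))" if "continuous_on {0..T} v" for v
    using that
    by (intro continuous_on_compose2[OF cont, of _ "\<lambda>s. (s, exp (K * s) *\<^sub>R v s)", simplified])
      (auto intro!: continuous_intros)
  have I_cont: "continuous_on {0..T} (I v)" if "continuous_on {0..T} v" for v
    unfolding I_def
    by (intro continuous_intros indefinite_integral_continuous_1 integrable_continuous_real G_cont that)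
  \<comment> \<open>Clamping the time extends \<open>I v\<close> by its end values, giving a
    self-map of the complete type of bounded continuous functions on the whole line.\<close>
  define \<Phi> where "\<Phi> v = Bcontfun (\<lambda>t. I (apply_bcontfun v) (clamp 0 T t))" for v :: "real \<Rightarrow>\<^sub>C 'a"
  have \<Phi>: "apply_bcontfun (\<Phi> v) t = I v (clamp 0 T t)" for v t
  proof -
    have "(\<lambda>t. I v (clamp 0 T t)) \<in> bcontfun"
      unfolding bcontfun_def
    proof (intro CollectI conjI)
      have *: "continuous_on (cbox 0 T) (I v)"
        using I_cont[of v] by (simp add: cbox_interval)
      then show "continuous_on UNIV (\<lambda>t. I v (clamp 0 T t))"
        by (rule clamp_continuous_on)
      show "bounded (range (\<lambda>t. I v (clamp 0 T t)))"
        using * by (intro clamp_bounded compact_imp_bounded compact_continuous_image) auto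
    qed
    then show ?thesis
      by (simp add: \<Phi>_def Bcontfun_inverse)
  qed
  have "\<exists>!v. \<Phi> v = v"
  proof (rule banach_fix_type[of "1/2"])
    show "\<forall>v w. dist (\<Phi> v) (\<Phi> w) \<le> 1/2 * dist v w"
    proof (intro allI dist_bound)
      fix v w :: "real \<Rightarrow>\<^sub>C 'a" and t
      define s where "s = clamp 0 T t"
      have s: "s \<in> {0..T}"
        using clamp_in_interval[of 0 T t] \<open>T \<ge> 0\<close> by (simp add: s_def)
      have int: "(\<lambda>r. G r (exp (K * r) *\<^sub>R v r)) integrable_on {0..s}" for v :: "real \<Rightarrow>\<^sub>C 'a"
        using s by (intro integrable_continuous_real continuous_on_subset[OF G_cont]) auto
      have E: "((\<lambda>r. L * dist v w * exp (K * r)) has_integral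
          (L * dist v w / K * exp (K * s) - L * dist v w / K * exp (K * 0))) {0..s}"
        using s K by (intro fundamental_theorem_of_calculus)
          (auto intro!: derivative_eq_intros simp: has_real_derivative_iff_has_vector_derivative[symmetric])
      have "norm (integral {0..s} (\<lambda>r. G r (exp (K * r) *\<^sub>R v r) - G r (exp (K * r) *\<^sub>R w r)))
          \<le> integral {0..s} (\<lambda>r. L * dist v w * exp (K * r))"
      proof (rule integral_norm_bound_integral)
        fix r assume r: "r \<in> {0..s}"
        have "norm (G r (exp (K * r) *\<^sub>R v r) - G r (exp (K * r) *\<^sub>R w r))
            \<le> L * norm (exp (K * r) *\<^sub>R v r - exp (K * r) *\<^sub>R w r)"
          using r s by (intro lip) auto
        also have "\<dots> = L * exp (K * r) * dist (v r) (w r)"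
          by (simp add: dist_norm flip: scaleR_diff_right)
        also have "\<dots> \<le> L * exp (K * r) * dist v w"
          using \<open>L > 0\<close> by (intro mult_left_mono dist_bounded) auto
        finally show "norm (G r (exp (K * r) *\<^sub>R v r) - G r (exp (K * r) *\<^sub>R w r))
            \<le> L * dist v w * exp (K * r)"
          by (simp add: mult_ac)
      qed (use E int in \<open>auto intro!: integrable_diff\<close>)
      also have "\<dots> = L * dist v w / K * exp (K * s) - L * dist v w / K"
        using integral_unique[OF E] by simp
      also have "\<dots> \<le> L * dist v w / K * exp (K * s)"
        using \<open>L > 0\<close> K by auto
      also have "L * dist v w / K = 1/2 * dist v w"
        using \<open>L > 0\<close> by (simp add: K_def)
      finally have *: "norm (integral {0..s} (\<lambda>r. G r (exp (K * r) *\<^sub>R v r))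
          - integral {0..s} (\<lambda>r. G r (exp (K * r) *\<^sub>R w r))) \<le> 1/2 * dist v w * exp (K * s)"
        by (simp add: integral_diff int)
      have "dist (\<Phi> v t) (\<Phi> w t) = exp (- K * s) * norm (integral {0..s} (\<lambda>r. G r (exp (K * r) *\<^sub>R v r))
          - integral {0..s} (\<lambda>r. G r (exp (K * r) *\<^sub>R w r)))"
        by (simp add: \<Phi> I_def dist_norm flip: s_def scaleR_diff_right)
      also have "\<dots> \<le> exp (- K * s) * (1/2 * dist v w * exp (K * s))"
        by (intro mult_left_mono *) auto
      also have "\<dots> = 1/2 * dist v w"
        by (simp add: exp_minus field_simps)
      finally show "dist (\<Phi> v t) (\<Phi> w t) \<le> 1/2 * dist v w" .
    qed
  qed auto
  then obtain v where v: "\<Phi> v = v" by auto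
  have fix_v: "v t = I v t" if "t \<in> {0..T}" for t
    using \<Phi>[of v t] that v by simp
  define u where "u t = exp (K * t) *\<^sub>R v t" for t
  have u_eq: "u t = x0 + integral {0..t} (\<lambda>s. G s (u s))" if "t \<in> {0..T}" for t
    using fix_v[OF that] by (simp add: u_def I_def exp_minus)
  show ?thesis
  proof (intro exI conjI ballI)
    show "u 0 = x0"
      using u_eq[of 0] \<open>T \<ge> 0\<close> by simp
    fix t assume t: "t \<in> {0..T}"
    have "continuous_on {0..T} (\<lambda>s. G s (u s))"
      unfolding u_def by (intro G_cont) auto
    from integral_has_vector_derivative[OF this t]
    have "((\<lambda>t. x0 + integral {0..t} (\<lambda>s. G s (u s))) has_vector_derivative G t (u t))
        (at t within {0..T})"
      by (auto intro!: derivative_eq_intros)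
    then show "(u has_vector_derivative G t (u t)) (at t within {0..T})"
      by (rule has_vector_derivative_transform[OF t, rotated]) (simp add: u_eq)
  qed
qed

text \<open>The explicit form shows that the projection of an outside point is a positive multiple
  of it, which is how coercivity passes to the cut-off field below.\<close>

lemma closest_point_cball_outside:
  fixes x :: "'a::euclidean_space"
  assumes "R > 0" "norm x \<ge> R"
  shows "closest_point (cball 0 R) x = (R / norm x) *\<^sub>R x"
proof (rule closest_point_unique[symmetric])
  have x: "norm x > 0" using assms by linarith
  show "(R / norm x) *\<^sub>R x \<in> cball 0 R"
    using assms x by simp
  have "1 - R / norm x \<ge> 0"
    using assms x by simp
  have "x - (R / norm x) *\<^sub>R x = (1 - R / norm x) *\<^sub>R x"
    by (simp only: scaleR_diff_left scaleR_one)
  then have "norm (x - (R / norm x) *\<^sub>R x) = (1 - R / norm x) * norm x"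
    using \<open>1 - R / norm x \<ge> 0\<close> by (simp only: norm_scaleR abs_of_nonneg)
  also have "\<dots> = norm x - R"
    using x by (simp add: left_diff_distrib)
  finally have "dist x ((R / norm x) *\<^sub>R x) = norm x - R"
    by (simp only: dist_norm)
  then show "\<forall>z\<in>cball 0 R. dist x ((R / norm x) *\<^sub>R x) \<le> dist x z"
    by (auto simp: dist_norm) (smt (verit) norm_triangle_ineq2)
qed auto

text \<open>The lattice fields are cubic, hence only locally Lipschitz; the one-sided bound on
  \<open>x \<bullet> F t x\<close> excludes blow-up. All constants may depend on the horizon
  \<open>T\<close>, since the noise is bounded on compact time intervals only.\<close>

locale coercive_ode =
  fixes F :: "real \<Rightarrow> 'a::euclidean_space \<Rightarrow> 'a"
  assumes cont: "continuous_on ({0..} \<times> UNIV) (\<lambda>(t, x). F t x)"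
    and lip: "\<And>T R. \<exists>L\<ge>0. \<forall>t\<in>{0..T}. \<forall>x\<in>cball 0 R. \<forall>y\<in>cball 0 R.
      norm (F t x - F t y) \<le> L * norm (x - y)"
    and coercive: "\<And>T. \<exists>C\<ge>0. \<forall>t\<in>{0..T}. \<forall>x. x \<bullet> F t x \<le> C * (1 + (norm x)\<^sup>2)"
begin

lemma unique_on:
  assumes u: "\<And>t. t \<in> {0..T} \<Longrightarrow> (u has_vector_derivative F t (u t)) (at t within {0..T})"
    and v: "\<And>t. t \<in> {0..T} \<Longrightarrow> (v has_vector_derivative F t (v t)) (at t within {0..T})"
    and "u 0 = v 0" and t: "t \<in> {0..T}"
  shows "u t = v t"
proof -
  have "continuous_on {0..T} u" "continuous_on {0..T} v"
    unfolding continuous_on_eq_continuous_within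
    using u v has_vector_derivative_continuous by blast+
  then have "bounded (u ` {0..T} \<union> v ` {0..T})"
    by (auto intro!: compact_imp_bounded compact_continuous_image)
  then obtain R where "\<forall>x\<in>u ` {0..T} \<union> v ` {0..T}. norm x \<le> R"
    unfolding bounded_iff by blast
  then have "u s \<in> cball 0 R" "v s \<in> cball 0 R" if "s \<in> {0..T}" for s
    using that by auto
  moreover obtain L where "L \<ge> 0" and "\<forall>t\<in>{0..T}. \<forall>x\<in>cball 0 R. \<forall>y\<in>cball 0 R.
      norm (F t x - F t y) \<le> L * norm (x - y)"
    using lip by blast
  ultimately have "(norm (u t - v t))\<^sup>2 \<le> exp ((2 * L + 1) * t) * ((norm (u 0 - v 0))\<^sup>2 + 0\<^sup>2)"
    by (intro gronwall_distance[OF u v _ _ t]) auto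
  then show ?thesis
    using \<open>u 0 = v 0\<close> by simp
qed

text \<open>Composition with the projection onto a ball makes the field globally Lipschitz; coercivity
  survives, and it keeps the solution inside the ball, where the field is unchanged.\<close>

lemma exists_on:
  assumes "T \<ge> 0"
  shows "\<exists>u. u 0 = x0 \<and> (\<forall>t\<in>{0..T}. (u has_vector_derivative F t (u t)) (at t within {0..T}))"
proof -
  obtain C where "C \<ge> 0" and C: "\<And>t x. t \<in> {0..T} \<Longrightarrow> x \<bullet> F t x \<le> C * (1 + (norm x)\<^sup>2)"
    using coercive[of T] by blast
  \<comment> \<open>The Gronwall bound at time \<open>T\<close> is itself taken as the radius. The
    rate is \<open>4 * C\<close> because the cut-off doubles the coercivity constant and
    differentiating the square doubles it again.\<close>
  define R where "R = sqrt (exp (4 * C * T) * (1 + (norm x0)\<^sup>2))"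
  have R2: "R\<^sup>2 = exp (4 * C * T) * (1 + (norm x0)\<^sup>2)"
    by (simp add: R_def)
  have "R \<ge> 1"
    using mult_mono[of 1 "exp (4 * C * T)" 1 "1 + (norm x0)\<^sup>2"] \<open>C \<ge> 0\<close> \<open>T \<ge> 0\<close>
    by (simp add: R_def)
  define p where "p = closest_point (cball (0::'a) R)"
  have p_in: "p x \<in> cball 0 R" for x
    unfolding p_def using \<open>R \<ge> 1\<close> by (intro closest_point_in_set) auto
  have p_lip: "norm (p x - p y) \<le> norm (x - y)" for x y
    unfolding p_def dist_norm[symmetric] using \<open>R \<ge> 1\<close> by (intro closest_point_lipschitz) auto
  have p_cont: "continuous_on UNIV p"
    unfolding p_def using \<open>R \<ge> 1\<close> by (intro continuous_on_closest_point) auto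
  have p_id: "p x = x" if "norm x \<le> R" for x
    unfolding p_def using that by (intro closest_point_self) auto
  obtain L where "L \<ge> 0" and L: "\<And>t x y. \<lbrakk>t \<in> {0..T}; x \<in> cball 0 R; y \<in> cball 0 R\<rbrakk> \<Longrightarrow>
      norm (F t x - F t y) \<le> L * norm (x - y)"
    using lip[of T R] by blast
  have "\<exists>u. u 0 = x0 \<and>
      (\<forall>t\<in>{0..T}. (u has_vector_derivative F t (p (u t))) (at t within {0..T}))"
  proof (rule picard_globally_lipschitz[where L = "L + 1"])
    have "continuous_on ({0..T} \<times> UNIV) (\<lambda>tx. (fst tx, p (snd tx)))"
      by (intro continuous_intros continuous_on_compose2[OF p_cont]) auto
    from continuous_on_compose2[OF cont this] \<open>T \<ge> 0\<close>
    show "continuous_on ({0..T} \<times> UNIV) (\<lambda>(t, x). F t (p x))"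
      by (simp add: case_prod_beta image_subset_iff)
    fix t x y assume "t \<in> {0..T}"
    then have "norm (F t (p x) - F t (p y)) \<le> L * norm (p x - p y)"
      by (intro L p_in)
    also have "\<dots> \<le> (L + 1) * norm (x - y)"
      using \<open>L \<ge> 0\<close> by (intro mult_mono p_lip) auto
    finally show "norm (F t (p x) - F t (p y)) \<le> (L + 1) * norm (x - y)" .
  qed (use \<open>L \<ge> 0\<close> \<open>T \<ge> 0\<close> in auto)
  then obtain u where "u 0 = x0"
    and u: "\<And>t. t \<in> {0..T} \<Longrightarrow> (u has_vector_derivative F t (p (u t))) (at t within {0..T})"
    by blast
  have Cp: "x \<bullet> F t (p x) \<le> 2 * C * (1 + (norm x)\<^sup>2)" if t: "t \<in> {0..T}" for t x
  proof (cases "norm x \<le> R")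
    case True
    then have "x \<bullet> F t (p x) \<le> 1 * (C * (1 + (norm x)\<^sup>2))"
      using C[OF t, of x] by (simp add: p_id)
    also have "\<dots> \<le> 2 * (C * (1 + (norm x)\<^sup>2))"
      using \<open>C \<ge> 0\<close> by (intro mult_right_mono) auto
    finally show ?thesis by simp
  next
    case False
    then have x: "norm x > R" by simp
    then have p: "p x = (R / norm x) *\<^sub>R x"
      using \<open>R \<ge> 1\<close> by (simp add: p_def closest_point_cball_outside)
    have "x \<noteq> 0"
      using x \<open>R \<ge> 1\<close> by auto
    with p have "norm (p x) = R"
      using \<open>R \<ge> 1\<close> by simp
    \<comment> \<open>Coercivity is applied at \<open>p x\<close>, of norm \<open>R\<close>, and
      rescaled. The factor 2 pays for \<open>|x| / R + R * |x| \<le> 2 * |x|^2\<close>, valid since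
      \<open>1 \<le> R < |x|\<close>.\<close>
    have "x \<bullet> F t (p x) = (norm x / R) * (p x \<bullet> F t (p x))"
      using \<open>x \<noteq> 0\<close> \<open>R \<ge> 1\<close> by (simp add: p)
    also have "\<dots> \<le> (norm x / R) * (C * (1 + R\<^sup>2))"
      using C[OF t, of "p x"] \<open>norm (p x) = R\<close> x \<open>R \<ge> 1\<close> by (intro mult_left_mono) auto
    also have "\<dots> = C * (norm x / R + R * norm x)"
      using \<open>R \<ge> 1\<close> by (simp add: field_simps power2_eq_square)
    also have "\<dots> \<le> C * (norm x * norm x + norm x * norm x)"
    proof (intro mult_left_mono add_mono mult_right_mono)
      have "norm x / R \<le> norm x / 1"
        using \<open>R \<ge> 1\<close> by (intro divide_left_mono) auto
      also have "\<dots> \<le> norm x * norm x"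
        using x \<open>R \<ge> 1\<close> mult_left_mono[of 1 "norm x" "norm x"] by simp
      finally show "norm x / R \<le> norm x * norm x" .
    qed (use x \<open>R \<ge> 1\<close> \<open>C \<ge> 0\<close> in auto)
    also have "\<dots> \<le> 2 * C * (1 + (norm x)\<^sup>2)"
      using \<open>C \<ge> 0\<close> by (simp add: algebra_simps power2_eq_square)
    finally show ?thesis .
  qed
  have u_bd: "norm (u t) \<le> R" if t: "t \<in> {0..T}" for t
  proof -
    have "1 + (norm (u t))\<^sup>2 \<le> exp (4 * C * t) * (1 + (norm (u 0))\<^sup>2)"
    proof (rule differential_gronwall[OF _ _ t])
      fix s assume s: "s \<in> {0..T}"
      show "((\<lambda>s. 1 + (norm (u s))\<^sup>2) has_vector_derivative 2 * (u s \<bullet> F s (p (u s)))) (at s within {0..T})"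
        using has_vector_derivative_inner_self[OF u[OF s]]
        by (auto intro!: derivative_eq_intros)
      show "2 * (u s \<bullet> F s (p (u s))) \<le> 4 * C * (1 + (norm (u s))\<^sup>2)"
        using Cp[OF s, of "u s"] by simp
    qed
    also have "\<dots> \<le> R\<^sup>2"
      unfolding R2 using t \<open>C \<ge> 0\<close> \<open>u 0 = x0\<close> by (intro mult_mono) (auto intro!: mult_left_mono)
    finally have "(norm (u t))\<^sup>2 \<le> R\<^sup>2" by simp
    then show ?thesis
      using \<open>R \<ge> 1\<close> by (simp add: power2_le_iff_abs_le)
  qed
  then show ?thesis
    using u \<open>u 0 = x0\<close> by (metis p_id)
qed

lemma solves_ivp_on:
  assumes "solves_ivp F x0 u" "t \<in> {0..T}"
  shows "(u has_vector_derivative F t (u t)) (at t within {0..T})"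
  using assms unfolding solves_ivp_def
  by (auto intro: has_vector_derivative_within_subset)

text \<open>Solutions for different horizons agree by uniqueness and can be glued. The solution with
  horizon \<open>t + 1\<close> is evaluated at \<open>t\<close>, so that \<open>t\<close> is never
  the right end, where the derivative would be one-sided.\<close>

lemma exists_ivp: "\<exists>u. solves_ivp F x0 u"
proof -
  have "\<exists>u. T \<ge> 0 \<longrightarrow> u 0 = x0 \<and>
      (\<forall>t\<in>{0..T}. (u has_vector_derivative F t (u t)) (at t within {0..T}))" for T
    using exists_on[of T] by blast
  then obtain U where U0: "\<And>T. T \<ge> 0 \<Longrightarrow> U T 0 = x0"
    and U: "\<And>t T. t \<in> {0..T} \<Longrightarrow> (U T has_vector_derivative F t (U T t)) (at t within {0..T})"
    by (metis atLeastAtMost_iff order_trans)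
  have agree: "U S t = U T t" if "t \<in> {0..S}" "t \<in> {0..T}" for S T t
  proof (rule unique_on[of "min S T"])
    fix s assume s: "s \<in> {0..min S T}"
    show "(U S has_vector_derivative F s (U S s)) (at s within {0..min S T})"
      "(U T has_vector_derivative F s (U T s)) (at s within {0..min S T})"
      using s by (auto intro!: has_vector_derivative_within_subset[OF U])
  qed (use that U0 in auto)
  have "solves_ivp F x0 (\<lambda>t. U (t + 1) t)"
    unfolding solves_ivp_def
  proof (intro conjI allI impI)
    fix t :: real assume t: "t \<ge> 0"
    have "at t within {0..t + 1} = at t within {0..}"
      by (rule at_within_nhd[of _ "{..<t + 1}"]) auto
    then have "(U (t + 1) has_vector_derivative F t (U (t + 1) t)) (at t within {0..})"
      using U[of t "t + 1"] t by simp
    then show "((\<lambda>t. U (t + 1) t) has_vector_derivative F t (U (t + 1) t)) (at t within {0..})"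
      by (rule has_vector_derivative_transform_within[where d = 1])
        (use t in \<open>auto intro!: agree simp: dist_real_def\<close>)
  qed (use U0 in simp)
  then show ?thesis by blast
qed

lemma solution_at_eq:
  assumes "solves_ivp F x0 u" "t \<ge> 0"
  shows "solution_at F t x0 = u t"
  unfolding solution_at_def
proof (rule the_equality)
  show "\<exists>v. solves_ivp F x0 v \<and> v t = u t"
    using assms by blast
next
  fix x assume "\<exists>v. solves_ivp F x0 v \<and> v t = x"
  then obtain v where v: "solves_ivp F x0 v" "v t = x" by blast
  have "v t = u t"
    by (rule unique_on[of t]) (use assms v in \<open>auto intro!: solves_ivp_on simp: solves_ivp_def\<close>)
  then show "x = u t"
    using v by simp
qed

text \<open>The description operator acts at each time separately; by uniqueness its values fit
  together into one trajectory.\<close>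

lemma solves_ivp_solution_at: "solves_ivp F x0 (\<lambda>t. solution_at F t x0)"
proof -
  obtain u where u: "solves_ivp F x0 u"
    using exists_ivp by blast
  have eq: "solution_at F t x0 = u t" if "t \<ge> 0" for t
    by (rule solution_at_eq[OF u that])
  show ?thesis
    unfolding solves_ivp_def
  proof (intro conjI allI impI)
    show "solution_at F 0 x0 = x0"
      using u eq[of 0] by (simp add: solves_ivp_def)
    fix t :: real assume t: "t \<ge> 0"
    then have "(u has_vector_derivative F t (u t)) (at t within {0..})"
      using u by (simp add: solves_ivp_def)
    then have "((\<lambda>t. solution_at F t x0) has_vector_derivative F t (u t)) (at t within {0..})"
      by (rule has_vector_derivative_transform[rotated 2]) (use t eq in auto)
    then show "((\<lambda>t. solution_at F t x0) has_vector_derivative F t (solution_at F t x0)) (at t within {0..})"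
      using eq t by simp
  qed
qed

lemma solution_at_0 [simp]: "solution_at F 0 x0 = x0"
  using solves_ivp_solution_at[of x0] by (simp add: solves_ivp_def)

lemma solution_at_has_derivative:
  assumes "t \<in> {0..T}"
  shows "((\<lambda>t. solution_at F t x0) has_vector_derivative F t (solution_at F t x0)) (at t within {0..T})"
  by (rule solves_ivp_on[OF solves_ivp_solution_at assms])

end

text \<open>A time translate of a solution of an autonomous equation solves it again, from the value
  at time \<open>t\<close>; uniqueness does the rest.\<close>

lemma solution_at_semigroup:
  assumes "coercive_ode (\<lambda>_. g)" "s \<ge> 0" "t \<ge> 0"
  shows "solution_at (\<lambda>_. g) (s + t) x = solution_at (\<lambda>_. g) s (solution_at (\<lambda>_. g) t x)"
proof -
  interpret coercive_ode "\<lambda>_. g" by fact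
  let ?S = "solution_at (\<lambda>_. g)"
  have "solves_ivp (\<lambda>_. g) (?S t x) (\<lambda>s. ?S (s + t) x)"
    unfolding solves_ivp_def
  proof (intro conjI allI impI)
    fix s :: real assume s: "s \<ge> 0"
    have "((\<lambda>r. ?S r x) has_vector_derivative g (?S (s + t) x)) (at (s + t) within {0..})"
      using solves_ivp_solution_at[of x] s \<open>t \<ge> 0\<close> by (simp add: solves_ivp_def)
    then have "((\<lambda>r. ?S r x) has_vector_derivative g (?S (s + t) x)) (at (s + t) within (\<lambda>r. r + t) ` {0..})"
      by (rule has_vector_derivative_within_subset) (use \<open>t \<ge> 0\<close> in auto)
    moreover have "((\<lambda>r. r + t) has_vector_derivative 1) (at s within {0..})"
      by (auto intro!: derivative_eq_intros)
    ultimately show "((\<lambda>s. ?S (s + t) x) has_vector_derivative g (?S (s + t) x)) (at s within {0..})"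
      using vector_diff_chain_within[of "\<lambda>r. r + t" 1 s "{0..}" "\<lambda>r. ?S r x"]
      by (simp add: o_def)
  qed simp
  from solution_at_eq[OF this \<open>s \<ge> 0\<close>] show ?thesis by simp
qed

section \<open>Locally Lipschitz fields and the lattice operators\<close>

text \<open>Joint continuity is part of the notion because a product of Lipschitz functions is
  Lipschitz only where the factors are bounded.\<close>

definition loc_lip :: "(real \<Rightarrow> 'a::euclidean_space \<Rightarrow> 'b::real_normed_vector) \<Rightarrow> bool" where
  "loc_lip g \<longleftrightarrow> continuous_on UNIV (\<lambda>(y, u). g y u) \<and>
     (\<forall>Y R. \<exists>L\<ge>0. \<forall>y\<in>{-Y..Y}. \<forall>u\<in>cball 0 R. \<forall>v\<in>cball 0 R.
        norm (g y u - g y v) \<le> L * norm (u - v))"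

lemma loc_lip_coeff:
  assumes "continuous_on UNIV c"
  shows "loc_lip (\<lambda>y u. c y)"
  unfolding loc_lip_def case_prod_beta
proof (intro conjI allI)
  show "continuous_on UNIV (\<lambda>p. c (fst p))"
    by (intro continuous_on_compose2[OF assms] continuous_intros) auto
qed (auto intro: exI[of _ 0])

lemma loc_lip_linear:
  assumes "bounded_linear h"
  shows "loc_lip (\<lambda>y u. h u)"
proof -
  interpret bounded_linear h by fact
  obtain K where K: "\<And>x. norm (h x) \<le> norm x * K" "K > 0"
    using pos_bounded by blast
  have "norm (h u - h v) \<le> K * norm (u - v)" for u v
    using K(1)[of "u - v"] by (simp add: diff mult.commute)
  moreover have "continuous_on UNIV (\<lambda>p :: real \<times> 'a. h (snd p))"
    by (intro continuous_on continuous_intros)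
  ultimately show ?thesis
    using K(2) unfolding loc_lip_def case_prod_beta by (meson less_imp_le)
qed

lemma loc_lip_bounded:
  assumes "loc_lip g"
  obtains B where "B \<ge> 0" "\<And>y u. y \<in> {-Y..Y} \<Longrightarrow> u \<in> cball 0 R \<Longrightarrow> norm (g y u) \<le> B"
proof -
  have "continuous_on ({-Y..Y} \<times> cball 0 R) (\<lambda>(y, u). g y u)"
    using assms unfolding loc_lip_def by (meson continuous_on_subset subset_UNIV)
  then have "bounded ((\<lambda>(y, u). g y u) ` ({-Y..Y} \<times> cball 0 R))"
    by (intro compact_imp_bounded compact_continuous_image compact_Times) auto
  then obtain B where "B > 0" and B: "\<And>p. p \<in> {-Y..Y} \<times> cball 0 R \<Longrightarrow> norm (case p of (y, u) \<Rightarrow> g y u) \<le> B"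
    unfolding bounded_pos by blast
  show ?thesis
  proof (rule that[of B])
    show "norm (g y u) \<le> B" if "y \<in> {-Y..Y}" "u \<in> cball 0 R" for y u
      using B[of "(y, u)"] that by simp
  qed (use \<open>B > 0\<close> in simp)
qed

lemma loc_lip_add:
  assumes g: "loc_lip g" and h: "loc_lip h"
  shows "loc_lip (\<lambda>y u. g y u + h y u)"
  unfolding loc_lip_def
proof (intro conjI allI)
  show "continuous_on UNIV (\<lambda>(y, u). g y u + h y u)"
    using g h unfolding loc_lip_def case_prod_beta by (intro continuous_intros) auto
  fix Y R
  obtain L where "L \<ge> 0" and L: "\<forall>y\<in>{-Y..Y}. \<forall>u\<in>cball 0 R. \<forall>v\<in>cball 0 R.
      norm (g y u - g y v) \<le> L * norm (u - v)"
    using g unfolding loc_lip_def by blast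
  obtain M where "M \<ge> 0" and M: "\<forall>y\<in>{-Y..Y}. \<forall>u\<in>cball 0 R. \<forall>v\<in>cball 0 R.
      norm (h y u - h y v) \<le> M * norm (u - v)"
    using h unfolding loc_lip_def by blast
  have "norm (g y u + h y u - (g y v + h y v)) \<le> (L + M) * norm (u - v)"
    if "y \<in> {-Y..Y}" "u \<in> cball 0 R" "v \<in> cball 0 R" for y u v
  proof -
    have "norm (g y u + h y u - (g y v + h y v)) \<le> norm (g y u - g y v) + norm (h y u - h y v)"
      by (rule norm_diff_triangle_ineq)
    also have "\<dots> \<le> L * norm (u - v) + M * norm (u - v)"
      using L M that by (intro add_mono) blast+
    finally show ?thesis by (simp add: distrib_right)
  qed
  then show "\<exists>L\<ge>0. \<forall>y\<in>{-Y..Y}. \<forall>u\<in>cball 0 R. \<forall>v\<in>cball 0 R.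
      norm (g y u + h y u - (g y v + h y v)) \<le> L * norm (u - v)"
    using \<open>L \<ge> 0\<close> \<open>M \<ge> 0\<close> by (intro exI[of _ "L + M"]) auto
qed

lemma loc_lip_mult:
  fixes g h :: "real \<Rightarrow> 'a::euclidean_space \<Rightarrow> 'b::real_normed_algebra"
  assumes g: "loc_lip g" and h: "loc_lip h"
  shows "loc_lip (\<lambda>y u. g y u * h y u)"
  unfolding loc_lip_def
proof (intro conjI allI)
  show "continuous_on UNIV (\<lambda>(y, u). g y u * h y u)"
    using g h unfolding loc_lip_def case_prod_beta by (intro continuous_intros) auto
  fix Y R
  obtain L where "L \<ge> 0" and L: "\<forall>y\<in>{-Y..Y}. \<forall>u\<in>cball 0 R. \<forall>v\<in>cball 0 R.
      norm (g y u - g y v) \<le> L * norm (u - v)"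
    using g unfolding loc_lip_def by blast
  obtain M where "M \<ge> 0" and M: "\<forall>y\<in>{-Y..Y}. \<forall>u\<in>cball 0 R. \<forall>v\<in>cball 0 R.
      norm (h y u - h y v) \<le> M * norm (u - v)"
    using h unfolding loc_lip_def by blast
  obtain A where A: "A \<ge> 0" "\<And>y u. y \<in> {-Y..Y} \<Longrightarrow> u \<in> cball 0 R \<Longrightarrow> norm (g y u) \<le> A"
    using loc_lip_bounded[OF g] by metis
  obtain B where B: "B \<ge> 0" "\<And>y u. y \<in> {-Y..Y} \<Longrightarrow> u \<in> cball 0 R \<Longrightarrow> norm (h y u) \<le> B"
    using loc_lip_bounded[OF h] by metis
  have "norm (g y u * h y u - g y v * h y v) \<le> (L * B + A * M) * norm (u - v)"
    if *: "y \<in> {-Y..Y}" "u \<in> cball 0 R" "v \<in> cball 0 R" for y u v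
  proof -
    have "g y u * h y u - g y v * h y v = (g y u - g y v) * h y u + g y v * (h y u - h y v)"
      by (simp add: algebra_simps)
    also have "norm \<dots> \<le> norm (g y u - g y v) * norm (h y u) + norm (g y v) * norm (h y u - h y v)"
      by (intro norm_triangle_le add_mono norm_mult_ineq)
    also have "\<dots> \<le> (L * norm (u - v)) * B + A * (M * norm (u - v))"
      using L M A B * \<open>L \<ge> 0\<close> by (intro add_mono mult_mono) auto
    finally show ?thesis by (simp add: algebra_simps)
  qed
  then show "\<exists>L\<ge>0. \<forall>y\<in>{-Y..Y}. \<forall>u\<in>cball 0 R. \<forall>v\<in>cball 0 R.
      norm (g y u * h y u - g y v * h y v) \<le> L * norm (u - v)"
    using \<open>L \<ge> 0\<close> \<open>M \<ge> 0\<close> A(1) B(1) by (intro exI[of _ "L * B + A * M"]) auto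
qed

lemma loc_lip_diff:
  fixes g h :: "real \<Rightarrow> 'a::euclidean_space \<Rightarrow> 'b::real_normed_algebra_1"
  assumes "loc_lip g" "loc_lip h"
  shows "loc_lip (\<lambda>y u. g y u - h y u)"
  using loc_lip_add[OF assms(1) loc_lip_mult[OF loc_lip_coeff[of "\<lambda>_. -1"] assms(2)]] by simp

lemma loc_lip_vec:
  fixes g :: "'n::finite \<Rightarrow> real \<Rightarrow> 'a::euclidean_space \<Rightarrow> real"
  assumes g: "\<And>i. loc_lip (g i)"
  shows "loc_lip (\<lambda>y u. \<chi> i. g i y u)"
  unfolding loc_lip_def
proof (intro conjI allI)
  show "continuous_on UNIV (\<lambda>(y, u). \<chi> i. g i y u)"
    using g unfolding loc_lip_def case_prod_beta by (intro continuous_on_vec_lambda) auto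
  fix Y R
  have "\<forall>i. \<exists>L\<ge>0. \<forall>y\<in>{-Y..Y}. \<forall>u\<in>cball 0 R. \<forall>v\<in>cball 0 R.
      norm (g i y u - g i y v) \<le> L * norm (u - v)"
    using g unfolding loc_lip_def by blast
  then obtain L where L: "\<And>i. L i \<ge> 0"
    "\<And>i y u v. y \<in> {-Y..Y} \<Longrightarrow> u \<in> cball 0 R \<Longrightarrow> v \<in> cball 0 R \<Longrightarrow>
      norm (g i y u - g i y v) \<le> L i * norm (u - v)"
    by metis
  have "norm ((\<chi> i. g i y u) - (\<chi> i. g i y v)) \<le> (\<Sum>i\<in>UNIV. L i) * norm (u - v)"
    if "y \<in> {-Y..Y}" "u \<in> cball 0 R" "v \<in> cball 0 R" for y u v
  proof -
    have "norm ((\<chi> i. g i y u) - (\<chi> i. g i y v)) \<le> (\<Sum>i\<in>UNIV. \<bar>g i y u - g i y v\<bar>)"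
      using norm_le_l1_cart[of "(\<chi> i. g i y u) - (\<chi> i. g i y v)"] by simp
    also have "\<dots> \<le> (\<Sum>i\<in>UNIV. L i * norm (u - v))"
      using L(2) that by (intro sum_mono) auto
    finally show ?thesis by (simp add: sum_distrib_right)
  qed
  then show "\<exists>L\<ge>0. \<forall>y\<in>{-Y..Y}. \<forall>u\<in>cball 0 R. \<forall>v\<in>cball 0 R.
      norm ((\<chi> i. g i y u) - (\<chi> i. g i y v)) \<le> L * norm (u - v)"
    using L(1) by (intro exI[of _ "\<Sum>i\<in>UNIV. L i"]) (auto intro: sum_nonneg)
qed

lemma loc_lip_cocycle_field:
  "loc_lip (cocycle_field \<alpha> \<beta> \<nu> lam \<gamma> f (ix :: 'n::finite \<Rightarrow> int))"
proof -
  have nth: "loc_lip (\<lambda>y u :: real ^ 'n. u $ i)" for i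
    by (rule loc_lip_linear) (rule bounded_linear_vec_nth)
  have mat: "loc_lip (\<lambda>y u. (A *v u) $ i)" for i and A :: "real ^ 'n ^ 'n"
    by (intro loc_lip_linear bounded_linear_compose[OF bounded_linear_vec_nth]
        matrix_vector_mul_bounded_linear)
  show ?thesis
    \<comment> \<open>With powers written as products, the field is built from linear maps and
      continuous coefficients by the closure rules alone.\<close>
    unfolding cocycle_field_def power2_eq_square power3_eq_cube
    by (intro loc_lip_vec loc_lip_add loc_lip_diff loc_lip_mult nth mat
        loc_lip_coeff continuous_intros)
qed

text \<open>Expanding, \<open>u * (1 - u) * (u - \<gamma>) = - u^3 + (1 + \<gamma>) * u^2 - \<gamma>
  * u\<close>; hence every estimate for \<open>cocycle_field\<close> covers the deterministic
  equation too.\<close>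

lemma cocycle_field_0:
  "cocycle_field \<alpha> \<beta> \<nu> lam \<gamma> f ix 0 = semigroup_field \<alpha> \<beta> \<nu> lam \<gamma> f ix"
  by (simp add: fun_eq_iff cocycle_field_def semigroup_field_def vec_eq_iff
      power2_eq_square power3_eq_cube algebra_simps)

section \<open>Quadratic and cubic bounds for the difference operators\<close>

text \<open>The value at the left neighbour, and \<open>0\<close> where there is none.\<close>

definition prev :: "('n::finite \<Rightarrow> int) \<Rightarrow> real ^ 'n \<Rightarrow> 'n \<Rightarrow> real" where
  "prev ix u i = (\<Sum>j\<in>UNIV. if ix i = ix j + 1 then u $ j else 0)"

lemma Dminus_nth:
  assumes "inj ix"
  shows "(Dminus ix *v u) $ i = prev ix u i - u $ i"
proof -
  have "(Dminus ix *v u) $ i =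
      (\<Sum>j\<in>UNIV. (if ix i = ix j + 1 then u $ j else 0) - (if i = j then u $ j else 0))"
    unfolding matrix_vector_mult_def Dminus_def
    using assms by (auto intro!: sum.cong simp: inj_eq)
  then show ?thesis
    by (simp add: prev_def sum_subtractf)
qed

text \<open>Passing to the left neighbour is injective where it is defined, so the left sum is part
  of the right one; an index without left neighbour contributes \<open>g 0 = 0\<close>.\<close>

lemma sum_prev_le:
  fixes g :: "real \<Rightarrow> real"
  assumes "inj ix" "\<And>x. g x \<ge> 0" "g 0 = 0"
  shows "(\<Sum>i\<in>UNIV. g (prev ix u i)) \<le> (\<Sum>i\<in>UNIV. g (u $ i))"
proof -
  define S where "S = {i. \<exists>j. ix i = ix j + 1}"
  \<comment> \<open>Meaningful on \<open>S\<close> only; elsewhere \<open>inv\<close> returns an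
    arbitrary index.\<close>
  define \<sigma> where "\<sigma> i = inv ix (ix i - 1)" for i
  have \<sigma>: "ix (\<sigma> i) = ix i - 1" if "i \<in> S" for i
    using that unfolding S_def \<sigma>_def by (auto intro!: f_inv_into_f)
  have prev: "prev ix u i = (if i \<in> S then u $ \<sigma> i else 0)" for i
  proof (cases "i \<in> S")
    case True
    have "ix i = ix j + 1 \<longleftrightarrow> j = \<sigma> i" for j
      using \<sigma>[OF True] \<open>inj ix\<close> by (auto simp: inj_eq dest: injD)
    then show ?thesis
      using True by (simp add: prev_def)
  next
    case False
    then show ?thesis by (auto simp: prev_def S_def intro!: sum.neutral)
  qed
  have "inj_on \<sigma> S"
    using \<sigma> \<open>inj ix\<close> by (metis (no_types, lifting) diff_add_cancel injD inj_onI)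
  have "(\<Sum>i\<in>UNIV. g (prev ix u i)) = (\<Sum>i\<in>S. g (u $ \<sigma> i))"
    using \<open>g 0 = 0\<close> by (intro sum.mono_neutral_cong_right) (auto simp: prev)
  also have "\<dots> = (\<Sum>j\<in>\<sigma> ` S. g (u $ j))"
    using \<open>inj_on \<sigma> S\<close> by (simp add: sum.reindex)
  also have "\<dots> \<le> (\<Sum>i\<in>UNIV. g (u $ i))"
    using assms(2) by (intro sum_mono2) auto
  finally show ?thesis .
qed

lemma norm_vec_power2: "(norm (u :: real ^ 'n::finite))\<^sup>2 = (\<Sum>i\<in>UNIV. (u $ i)\<^sup>2)"
  unfolding power2_norm_eq_inner inner_vec_def by (simp add: power2_eq_square)

text \<open>\<open>Lam\<close> enters the equation with a plus sign, so this term feeds energy. Its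
  quadratic form is \<open>|D u|^2\<close>, and \<open>(a - b)^2 \<le> 2 * a^2 + 2 * b^2\<close>
  yields the 4 in the summand \<open>4 * \<nu>\<close> of \<open>lam_star\<close>.\<close>

lemma inner_Lam_le:
  assumes "inj ix"
  shows "u \<bullet> (Lam ix *v u) \<le> 4 * (norm u)\<^sup>2"
proof -
  have "u \<bullet> (Lam ix *v u) = (norm (Dminus ix *v u))\<^sup>2"
    unfolding Lam_def matrix_vector_mul_assoc[symmetric] power2_norm_eq_inner
    by (simp add: transpose_matrix_vector dot_lmul_matrix inner_commute[of u])
  also have "\<dots> = (\<Sum>i\<in>UNIV. (prev ix u i - u $ i)\<^sup>2)"
    by (simp add: norm_vec_power2 Dminus_nth assms)
  also have "\<dots> \<le> (\<Sum>i\<in>UNIV. 2 * (prev ix u i)\<^sup>2 + 2 * (u $ i)\<^sup>2)"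
  proof (rule sum_mono)
    fix i
    show "(prev ix u i - u $ i)\<^sup>2 \<le> 2 * (prev ix u i)\<^sup>2 + 2 * (u $ i)\<^sup>2"
      using zero_le_power2[of "prev ix u i + u $ i"] by (simp add: power2_eq_square algebra_simps)
  qed
  also have "\<dots> = 2 * (\<Sum>i\<in>UNIV. (prev ix u i)\<^sup>2) + 2 * (\<Sum>i\<in>UNIV. (u $ i)\<^sup>2)"
    by (simp add: sum.distrib sum_distrib_left)
  also have "\<dots> \<le> 4 * (\<Sum>i\<in>UNIV. (u $ i)\<^sup>2)"
    using sum_prev_le[OF assms, of "\<lambda>x. x\<^sup>2" u] by simp
  finally show ?thesis
    by (simp add: norm_vec_power2)
qed

text \<open>Young's inequality splits the mixed term into \<open>2/3\<close> and \<open>1/3\<close>;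
  the weights \<open>5/3\<close> on \<open>u\<close> and \<open>1/3\<close> on its neighbour add up
  to the 2 in the summand \<open>2 * \<alpha>\<close> of \<open>lam_star\<close>.\<close>

lemma convection_le:
  assumes "inj ix"
  shows "- (\<Sum>i\<in>UNIV. (u $ i)\<^sup>2 * (Dminus ix *v u) $ i) \<le> 2 * (\<Sum>i\<in>UNIV. \<bar>u $ i\<bar> ^ 3)"
proof -
  have young: "a\<^sup>2 * b \<le> (2 * a ^ 3 + b ^ 3) / 3" if "a \<ge> 0" "b \<ge> 0" for a b :: real
  proof -
    \<comment> \<open>The product equals \<open>2 * a^3 - 3 * a^2 * b + b^3\<close>.\<close>
    have "0 \<le> (a - b)\<^sup>2 * (2 * a + b)"
      using that by simp
    then show ?thesis
      by (simp add: power2_eq_square power3_eq_cube algebra_simps)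
  qed
  have "- (\<Sum>i\<in>UNIV. (u $ i)\<^sup>2 * (Dminus ix *v u) $ i) = (\<Sum>i\<in>UNIV. (u $ i)\<^sup>2 * (u $ i - prev ix u i))"
    by (simp add: Dminus_nth assms right_diff_distrib flip: sum_negf)
  also have "\<dots> \<le> (\<Sum>i\<in>UNIV. (5 / 3) * \<bar>u $ i\<bar> ^ 3 + (1 / 3) * \<bar>prev ix u i\<bar> ^ 3)"
  proof (rule sum_mono)
    fix i
    have "(u $ i)\<^sup>2 * (u $ i - prev ix u i) \<le> (u $ i)\<^sup>2 * (\<bar>u $ i\<bar> + \<bar>prev ix u i\<bar>)"
      by (intro mult_left_mono) auto
    also have "\<dots> = \<bar>u $ i\<bar> ^ 3 + \<bar>u $ i\<bar>\<^sup>2 * \<bar>prev ix u i\<bar>"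
      by (simp add: algebra_simps power2_eq_square power3_eq_cube)
    also have "\<dots> \<le> (5 / 3) * \<bar>u $ i\<bar> ^ 3 + (1 / 3) * \<bar>prev ix u i\<bar> ^ 3"
      using young[of "\<bar>u $ i\<bar>" "\<bar>prev ix u i\<bar>"] by simp
    finally show "(u $ i)\<^sup>2 * (u $ i - prev ix u i) \<le> (5 / 3) * \<bar>u $ i\<bar> ^ 3 + (1 / 3) * \<bar>prev ix u i\<bar> ^ 3" .
  qed
  also have "\<dots> = (5 / 3) * (\<Sum>i\<in>UNIV. \<bar>u $ i\<bar> ^ 3) + (1 / 3) * (\<Sum>i\<in>UNIV. \<bar>prev ix u i\<bar> ^ 3)"
    by (simp add: sum.distrib sum_distrib_left)
  also have "\<dots> \<le> 2 * (\<Sum>i\<in>UNIV. \<bar>u $ i\<bar> ^ 3)"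
    using sum_prev_le[OF assms, of "\<lambda>x. \<bar>x\<bar> ^ 3" u] by simp
  finally show ?thesis .
qed

section \<open>The energy inequality\<close>

locale lattice_model =
  fixes \<alpha> \<beta> \<nu> lam \<gamma> :: real and f :: "int \<Rightarrow> real" and ix :: "'n::finite \<Rightarrow> int"
  assumes params: "\<alpha> > 0" "\<beta> > 0" "\<nu> > 0" "0 < \<gamma>" "lam > lam_star \<alpha> \<beta> \<nu> \<gamma>"
    and inj_ix: "inj ix"
begin

abbreviation field :: "real \<Rightarrow> real ^ 'n \<Rightarrow> real ^ 'n" where
  "field \<equiv> cocycle_field \<alpha> \<beta> \<nu> lam \<gamma> f ix"

text \<open>One half of the surplus remains as linear damping; the other half enlarges the quadratic
  weight in Young's inequality. Without that enlargement the cubic terms would use up the quartic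
  damping completely.\<close>

definition gap :: real where "gap = (lam - lam_star \<alpha> \<beta> \<nu> \<gamma>) / 2"

text \<open>The coefficient of the quartic damping that is left when Young's inequality spends only
  as much of it on the cubic terms as \<open>gap\<close> permits; the factor \<open>1 / CARD('n)\<close> comes from the
  Cauchy-Schwarz inequality between the \<open>\<ell>\<close>-2 and \<open>\<ell>\<close>-4 norms.\<close>

definition quart :: real where
  "quart = (\<beta> - (2 * \<alpha> + \<beta> + \<beta> * \<gamma>)\<^sup>2 / (4 * ((2 * \<alpha> + \<beta> + \<beta> * \<gamma>)\<^sup>2 / (4 * \<beta>) + gap))) / CARD('n)"

definition force :: real where "force = norm (\<chi> i. f (ix i) :: real ^ 'n)"

lemma gap_pos: "gap > 0"
  using params by (simp add: gap_def)

lemma quart_pos: "quart > 0"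
proof -
  let ?c = "2 * \<alpha> + \<beta> + \<beta> * \<gamma>"
  let ?q = "?c\<^sup>2 / (4 * \<beta>) + gap"
  have "?c\<^sup>2 / (4 * \<beta>) \<ge> 0"
    using params by simp
  then have "?q > 0" using gap_pos by linarith
  have "4 * ?q * \<beta> = ?c\<^sup>2 + 4 * gap * \<beta>"
    using params by (simp add: field_simps)
  also have "\<dots> > ?c\<^sup>2"
    using params gap_pos by simp
  finally have "?c\<^sup>2 / (4 * ?q) < \<beta>"
    using \<open>?q > 0\<close> by (simp add: divide_less_eq mult.commute)
  then show ?thesis
    by (simp add: quart_def)
qed

text \<open>Convection and reaction together give the cubic coefficient
  \<open>2 * \<alpha> + \<beta> + \<beta> * \<gamma>\<close>. Young's inequality with quadratic
  weight \<open>?q\<close> turns \<open>exp y * a^3\<close> into \<open>a^2\<close> and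
  \<open>exp (2 * y) * a^4\<close>, so the exponentials match the quartic damping.\<close>

lemma field_inner_le:
  "u \<bullet> field y u \<le> (y - gap) * (norm u)\<^sup>2 + exp (- y) * force * norm u
    - quart * exp (2 * y) * ((norm u)\<^sup>2)\<^sup>2"
proof -
  let ?E = "exp y" and ?c = "2 * \<alpha> + \<beta> + \<beta> * \<gamma>"
  let ?q = "?c\<^sup>2 / (4 * \<beta>) + gap"
  let ?d = "\<beta> - ?c\<^sup>2 / (4 * ?q)"
  have "?c\<^sup>2 / (4 * \<beta>) \<ge> 0"
    using params by simp
  then have "?q > 0" using gap_pos by linarith
  let ?C = "\<Sum>i\<in>UNIV. \<bar>u $ i\<bar> ^ 3"
  have E2: "exp (2 * y) = ?E * ?E"
    by (simp add: exp_add[symmetric])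
  have "u \<bullet> field y u = \<nu> * (u \<bullet> (Lam ix *v u))
      + \<alpha> * ?E * (- (\<Sum>i\<in>UNIV. (u $ i)\<^sup>2 * (Dminus ix *v u) $ i))
      + (\<Sum>i\<in>UNIV. \<beta> * (1 + \<gamma>) * ?E * (u $ i) ^ 3 - \<beta> * ?E\<^sup>2 * (u $ i) ^ 4)
      - (\<beta> * \<gamma> + lam) * (norm u)\<^sup>2 + exp (- y) * (u \<bullet> (\<chi> i. f (ix i))) + y * (norm u)\<^sup>2"
    unfolding inner_vec_def cocycle_field_def norm_vec_power2 E2
    by (simp add: sum_distrib_left power2_eq_square power3_eq_cube power4_eq_xxxx
        algebra_simps flip: sum.distrib sum_subtractf sum_negf)
  also have "\<dots> \<le> \<nu> * (4 * (norm u)\<^sup>2) + \<alpha> * ?E * (2 * ?C)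
      + (\<Sum>i\<in>UNIV. \<beta> * (1 + \<gamma>) * ?E * \<bar>u $ i\<bar> ^ 3 - \<beta> * ?E\<^sup>2 * (u $ i) ^ 4)
      - (\<beta> * \<gamma> + lam) * (norm u)\<^sup>2 + exp (- y) * (norm u * force) + y * (norm u)\<^sup>2"
  proof -
    have "\<nu> * (u \<bullet> (Lam ix *v u)) \<le> \<nu> * (4 * (norm u)\<^sup>2)"
      using params by (intro mult_left_mono inner_Lam_le inj_ix) auto
    moreover have "\<alpha> * ?E * (- (\<Sum>i\<in>UNIV. (u $ i)\<^sup>2 * (Dminus ix *v u) $ i)) \<le> \<alpha> * ?E * (2 * ?C)"
      using params by (intro mult_left_mono convection_le inj_ix) auto
    moreover have "\<beta> * (1 + \<gamma>) * ?E * (u $ i) ^ 3 \<le> \<beta> * (1 + \<gamma>) * ?E * \<bar>u $ i\<bar> ^ 3" for i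
    proof (rule mult_left_mono)
      show "(u $ i) ^ 3 \<le> \<bar>u $ i\<bar> ^ 3"
        by (metis abs_ge_self power_abs)
    qed (use params in auto)
    moreover have "exp (- y) * (u \<bullet> (\<chi> i. f (ix i))) \<le> exp (- y) * (norm u * force)"
      unfolding force_def by (intro mult_left_mono norm_cauchy_schwarz) auto
    ultimately show ?thesis
      by (intro add_mono diff_mono sum_mono order_refl)
  qed
  finally have le: "u \<bullet> field y u \<le> \<nu> * (4 * (norm u)\<^sup>2) + \<alpha> * ?E * (2 * ?C)
      + (\<Sum>i\<in>UNIV. \<beta> * (1 + \<gamma>) * ?E * \<bar>u $ i\<bar> ^ 3 - \<beta> * ?E\<^sup>2 * (u $ i) ^ 4)
      - (\<beta> * \<gamma> + lam) * (norm u)\<^sup>2 + exp (- y) * (norm u * force) + y * (norm u)\<^sup>2" .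
  have "\<alpha> * ?E * (2 * ?C)
      + (\<Sum>i\<in>UNIV. \<beta> * (1 + \<gamma>) * ?E * \<bar>u $ i\<bar> ^ 3 - \<beta> * ?E\<^sup>2 * (u $ i) ^ 4)
      = (\<Sum>i\<in>UNIV. ?c * ?E * \<bar>u $ i\<bar> ^ 3 - \<beta> * ?E\<^sup>2 * (u $ i) ^ 4)"
    by (simp add: sum_distrib_left algebra_simps sum.distrib sum_subtractf)
  also have "\<dots> \<le> (\<Sum>i\<in>UNIV. ?q * (u $ i)\<^sup>2 - ?d * ?E\<^sup>2 * (u $ i) ^ 4)"
  proof (rule sum_mono)
    fix i
    define a where "a = \<bar>u $ i\<bar>"
    define q where "q = ?q"
    have a: "(u $ i) ^ 4 = a ^ 4" "(u $ i)\<^sup>2 = a\<^sup>2"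
      by (simp_all add: a_def)
    have "q > 0" unfolding q_def by fact
    \<comment> \<open>Young's inequality as a completed square, multiplied by
      \<open>a^2\<close>.\<close>
    then have "0 \<le> a\<^sup>2 * (2 * q - ?c * ?E * a)\<^sup>2 / (4 * q)"
      by (intro divide_nonneg_pos mult_nonneg_nonneg) auto
    also have "\<dots> = q * a\<^sup>2 - ?c * ?E * a ^ 3 + ?c\<^sup>2 / (4 * q) * ?E\<^sup>2 * a ^ 4"
      using \<open>q > 0\<close> by (simp add: field_simps power2_eq_square power3_eq_cube power4_eq_xxxx)
    finally show "?c * ?E * \<bar>u $ i\<bar> ^ 3 - \<beta> * ?E\<^sup>2 * (u $ i) ^ 4 \<le> ?q * (u $ i)\<^sup>2 - ?d * ?E\<^sup>2 * (u $ i) ^ 4"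
      unfolding a a_def[symmetric] q_def[symmetric] by (simp add: left_diff_distrib)
  qed
  also have "\<dots> = ?q * (norm u)\<^sup>2 - ?d * ?E\<^sup>2 * (\<Sum>i\<in>UNIV. ((u $ i)\<^sup>2)\<^sup>2)"
    by (simp add: norm_vec_power2 sum_distrib_left sum_subtractf)
  also have "\<dots> \<le> ?q * (norm u)\<^sup>2 - quart * ?E\<^sup>2 * ((norm u)\<^sup>2)\<^sup>2"
  proof -
    have d: "?d = quart * CARD('n)"
      by (simp add: quart_def)
    have "((norm u)\<^sup>2)\<^sup>2 \<le> CARD('n) * (\<Sum>i\<in>UNIV. ((u $ i)\<^sup>2)\<^sup>2)"
      unfolding norm_vec_power2
      using sum_squared_le_sum_of_squares[of "\<lambda>i. (u $ i)\<^sup>2" UNIV] by (simp add: mult.commute)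
    then have "quart * ?E\<^sup>2 * ((norm u)\<^sup>2)\<^sup>2 \<le> quart * ?E\<^sup>2 * (CARD('n) * (\<Sum>i\<in>UNIV. ((u $ i)\<^sup>2)\<^sup>2))"
      using quart_pos by (intro mult_left_mono) auto
    then show ?thesis
      unfolding d by (simp add: mult_ac)
  qed
  finally have "\<alpha> * ?E * (2 * ?C)
      + (\<Sum>i\<in>UNIV. \<beta> * (1 + \<gamma>) * ?E * \<bar>u $ i\<bar> ^ 3 - \<beta> * ?E\<^sup>2 * (u $ i) ^ 4)
      \<le> ?q * (norm u)\<^sup>2 - quart * ?E\<^sup>2 * ((norm u)\<^sup>2)\<^sup>2" .
  with le have "u \<bullet> field y u \<le> \<nu> * (4 * (norm u)\<^sup>2) + (?q * (norm u)\<^sup>2 - quart * ?E\<^sup>2 * ((norm u)\<^sup>2)\<^sup>2)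
      - (\<beta> * \<gamma> + lam) * (norm u)\<^sup>2 + exp (- y) * (norm u * force) + y * (norm u)\<^sup>2"
    by linarith
  also have "\<dots> = (4 * \<nu> + ?q - (\<beta> * \<gamma> + lam) + y) * (norm u)\<^sup>2 + exp (- y) * force * norm u
      - quart * exp (2 * y) * ((norm u)\<^sup>2)\<^sup>2"
    by (simp only: exp_double) (simp add: algebra_simps)
  \<comment> \<open>Here \<open>4 * \<nu> + ?q - \<beta> * \<gamma>\<close> is
    \<open>lam_star + gap\<close>, and \<open>lam\<close> is
    \<open>lam_star + 2 * gap\<close>.\<close>
  also have "4 * \<nu> + ?q - (\<beta> * \<gamma> + lam) + y = y - gap"
    unfolding gap_def lam_star_def by (simp add: field_simps)
  finally show ?thesis .
qed

text \<open>The first summand comes from completing the square with the forcing, at the expense of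
  half the linear damping; the second is the maximum of
  \<open>2 * X - 2 * quart * X^2\<close>.\<close>

definition energy :: real where "energy = force\<^sup>2 / gap + 1 / (2 * quart)"

lemma energy_pos: "energy > 0"
  unfolding energy_def using gap_pos quart_pos by (intro add_nonneg_pos) auto

text \<open>The quartic term absorbs the growth caused by a positive \<open>y\<close>, so the decay rate on the
  right-hand side does not depend on \<open>y\<close>.\<close>

lemma field_energy_le:
  "2 * (u \<bullet> field y u) \<le> - gap * (norm u)\<^sup>2 + energy * exp (2 * \<bar>y\<bar>)"
proof -
  let ?w = "(norm u)\<^sup>2"
  have "0 \<le> (gap * norm u - exp (- y) * force)\<^sup>2 / gap"
    using gap_pos by simp
  also have "\<dots> = gap * ?w - 2 * (exp (- y) * force * norm u) + (exp (- y))\<^sup>2 * (force\<^sup>2 / gap)"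
    using gap_pos by (simp add: power2_diff power_mult_distrib field_simps power2_eq_square)
  finally have 1: "2 * (exp (- y) * force * norm u) \<le> gap * ?w + (exp (- y))\<^sup>2 * (force\<^sup>2 / gap)"
    by simp
  have "(exp (- y))\<^sup>2 * (force\<^sup>2 / gap) \<le> exp (2 * \<bar>y\<bar>) * (force\<^sup>2 / gap)"
    using gap_pos by (intro mult_right_mono) (auto simp flip: exp_double)
  moreover have "2 * y * ?w - 2 * quart * exp (2 * y) * ?w\<^sup>2 \<le> exp (2 * \<bar>y\<bar>) * (1 / (2 * quart))"
  proof -
    \<comment> \<open>In this variable the growth \<open>y * ?w \<le> X\<close> competes with the
      damping \<open>quart * X^2\<close>, and \<open>y\<close> drops out of the resulting
      bound.\<close>
    define X where "X = exp y * ?w"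
    have "y * ?w \<le> exp y * ?w"
    proof (rule mult_right_mono)
      show "y \<le> exp y"
        using exp_ge_add_one_self[of y] by linarith
    qed simp
    moreover have "quart * exp (2 * y) * ?w\<^sup>2 = quart * X\<^sup>2"
      by (simp add: X_def power_mult_distrib exp_double)
    moreover have "0 \<le> (2 * quart * X - 1)\<^sup>2 / (2 * quart)"
      using quart_pos by simp
    then have "2 * X - 2 * quart * X\<^sup>2 \<le> 1 / (2 * quart)"
      using quart_pos by (simp add: field_simps power2_eq_square)
    moreover have "1 * (1 / (2 * quart)) \<le> exp (2 * \<bar>y\<bar>) * (1 / (2 * quart))"
      using quart_pos by (intro mult_right_mono) auto
    ultimately show ?thesis
      unfolding X_def by linarith
  qed
  ultimately show ?thesis
    using field_inner_le[of u y] 1 by (simp add: energy_def algebra_simps)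
qed

text \<open>A continuous \<open>y\<close> is bounded on \<open>{0..T}\<close>, which makes the
  Lipschitz and growth constants of the field uniform there.\<close>

lemma coercive_ode_field:
  assumes "continuous_on {0..} y"
  shows "coercive_ode (\<lambda>t. field (y t))"
proof
  have cont: "continuous_on UNIV (\<lambda>(y, u). field y u)"
    using loc_lip_cocycle_field unfolding loc_lip_def by blast
  have "continuous_on ({0..} \<times> UNIV) (\<lambda>tx. (y (fst tx), snd tx))"
    using assms by (auto intro!: continuous_intros continuous_on_compose2[of "{0..}" y])
  from continuous_on_compose2[OF cont this]
  show "continuous_on ({0..} \<times> UNIV) (\<lambda>(t, x). field (y t) x)"
    by (simp add: case_prod_beta)
  have bd: "\<exists>Y\<ge>0. \<forall>t\<in>{0..T}. y t \<in> {-Y..Y}" for T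
  proof -
    have "bounded (y ` {0..T})"
      by (intro compact_imp_bounded compact_continuous_image continuous_on_subset[OF assms]) auto
    then obtain Y where Y: "Y > 0" "\<And>t. t \<in> {0..T} \<Longrightarrow> \<bar>y t\<bar> \<le> Y"
      unfolding bounded_pos by auto
    have "y t \<in> {-Y..Y}" if "t \<in> {0..T}" for t
      using Y(2)[OF that] by (simp add: abs_le_iff)
    with Y(1) show ?thesis
      by (intro exI[of _ Y]) simp
  qed
  show "\<exists>L\<ge>0. \<forall>t\<in>{0..T}. \<forall>u\<in>cball 0 R. \<forall>v\<in>cball 0 R.
      norm (field (y t) u - field (y t) v) \<le> L * norm (u - v)" for T R
  proof -
    obtain Y where "\<forall>t\<in>{0..T}. y t \<in> {-Y..Y}"
      using bd by blast
    moreover obtain L where "L \<ge> 0" "\<forall>z\<in>{-Y..Y}. \<forall>u\<in>cball 0 R. \<forall>v\<in>cball 0 R.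
        norm (field z u - field z v) \<le> L * norm (u - v)"
      using loc_lip_cocycle_field unfolding loc_lip_def by blast
    ultimately show ?thesis by blast
  qed
  show "\<exists>C\<ge>0. \<forall>t\<in>{0..T}. \<forall>u. u \<bullet> field (y t) u \<le> C * (1 + (norm u)\<^sup>2)" for T
  proof -
    obtain Y where "Y \<ge> 0" and Y: "\<forall>t\<in>{0..T}. y t \<in> {-Y..Y}"
      using bd by blast
    have "force \<ge> 0"
      by (simp add: force_def)
    have "u \<bullet> field (y t) u \<le> (Y + exp Y * force) * (1 + (norm u)\<^sup>2)" if "t \<in> {0..T}" for t u
    proof -
      have y: "\<bar>y t\<bar> \<le> Y" using Y that by (fastforce simp: abs_le_iff)
      have "norm u \<le> 1 + (norm u)\<^sup>2"
        using zero_le_power2[of "norm u - 1/2"] by (simp add: power2_diff power_divide)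
      have "u \<bullet> field (y t) u \<le> (y t - gap) * (norm u)\<^sup>2 + exp (- y t) * force * norm u
          - quart * exp (2 * y t) * ((norm u)\<^sup>2)\<^sup>2"
        by (rule field_inner_le)
      also have "\<dots> \<le> (y t - gap) * (norm u)\<^sup>2 + exp (- y t) * force * norm u"
        using quart_pos by simp
      also have "\<dots> \<le> Y * (1 + (norm u)\<^sup>2) + exp Y * force * (1 + (norm u)\<^sup>2)"
        using y gap_pos \<open>Y \<ge> 0\<close> \<open>force \<ge> 0\<close> \<open>norm u \<le> 1 + (norm u)\<^sup>2\<close>
        by (intro add_mono mult_mono) auto
      finally show ?thesis by (simp add: algebra_simps)
    qed
    then show ?thesis
      using \<open>Y \<ge> 0\<close> \<open>force \<ge> 0\<close> by (intro exI[of _ "Y + exp Y * force"]) auto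
  qed
qed

end

section \<open>Attractors of semigroups with a compact absorbing set\<close>

lemma semidist_le:
  assumes "\<And>a. a \<in> A \<Longrightarrow> \<exists>b\<in>B. dist a b \<le> e"
  shows "semidist A B \<le> ennreal e"
  unfolding semidist_def
proof (rule SUP_least)
  fix a assume "a \<in> A"
  then obtain b where "b \<in> B" "dist a b \<le> e"
    using assms by blast
  then show "(INF b\<in>B. ennreal (dist a b)) \<le> ennreal e"
    by (intro INF_lower2[of b] ennreal_leI)
qed

lemma tendsto_0_ennrealI:
  fixes g :: "'b \<Rightarrow> ennreal"
  assumes "\<And>e :: real. e > 0 \<Longrightarrow> eventually (\<lambda>x. g x \<le> ennreal e) F"
  shows "(g \<longlongrightarrow> 0) F"
proof (rule order_tendstoI)
  fix a :: ennreal assume "0 < a"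
  \<comment> \<open>A value strictly below \<open>a\<close> is finite, hence a positive real to
    which the assumption applies.\<close>
  then obtain b where b: "0 < b" "b < a"
    using dense by blast
  then have "b < top"
    by (auto intro: less_le_trans)
  then have "b = ennreal (enn2real b)" "enn2real b > 0"
    using b by (auto simp: enn2real_positive_iff)
  then show "eventually (\<lambda>x. g x < a) F"
    using assms[of "enn2real b"] b(2) by (auto elim!: eventually_mono)
qed simp

text \<open>Positive invariance makes the images of \<open>B\<close> decrease, so their intersection
  is the attractor by compactness. The second conjunct, attraction of \<open>B\<close> at one time
  in metric form, is what the comparison with the random attractors consumes.\<close>

lemma global_attractor_of_absorbing:
  fixes S :: "real \<Rightarrow> 'a::heine_borel \<Rightarrow> 'a"
  assumes B: "compact B" "B \<noteq> {}"
    and cont: "\<And>t. t \<ge> 0 \<Longrightarrow> continuous_on B (S t)"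
    and semigroup: "\<And>s t x. s \<ge> 0 \<Longrightarrow> t \<ge> 0 \<Longrightarrow> S (s + t) x = S s (S t x)"
    and inv: "\<And>t. t \<ge> 0 \<Longrightarrow> S t ` B \<subseteq> B"
    and absorbing: "\<And>D. bounded D \<Longrightarrow> \<exists>t\<ge>0. S t ` D \<subseteq> B"
  shows "\<exists>A. global_attractor S A \<and> (\<forall>e>0. \<exists>t\<ge>0. \<forall>x\<in>B. \<exists>a\<in>A. dist (S t x) a < e)"
proof -
  \<comment> \<open>The truncation makes the nested family indexed by all reals, as
    \<open>compact_nest\<close> expects.\<close>
  define F where "F t = S (max 0 t) ` B" for t :: real
  define A where "A = \<Inter>(range F)"
  have F_compact: "compact (F t)" for t
    unfolding F_def using cont B by (intro compact_continuous_image) auto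
  have F_nonempty: "F t \<noteq> {}" for t
    using B by (simp add: F_def)
  have F_mono: "F t \<subseteq> F s" if "s \<le> t" for s t
  proof -
    have "max 0 t = max 0 s + (max 0 t - max 0 s)" by simp
    then have "S (max 0 t) x = S (max 0 s) (S (max 0 t - max 0 s) x)" for x
      using that semigroup[of "max 0 s" "max 0 t - max 0 s"] by simp
    then show ?thesis
      using inv[of "max 0 t - max 0 s"] that unfolding F_def by fastforce
  qed
  have F_step: "S s x \<in> F (s + t)" if "s \<ge> 0" "t \<ge> 0" "x \<in> F t" for s t x
    using that semigroup unfolding F_def by force
  have "A \<subseteq> F 0" "A \<noteq> {}" "compact A"
    unfolding A_def using compact_nest[of F] F_compact F_nonempty F_mono
    by (auto intro!: compact_Inter)
  have "F 0 \<subseteq> B"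
    using inv[of 0] by (simp add: F_def)
  have "A \<subseteq> B"
    using \<open>A \<subseteq> F 0\<close> \<open>F 0 \<subseteq> B\<close> by blast
  have invariant: "S s ` A = A" if s: "s \<ge> 0" for s
  proof
    show "S s ` A \<subseteq> A"
    proof
      fix y assume "y \<in> S s ` A"
      then obtain x where x: "x \<in> A" "y = S s x" by blast
      have "y \<in> F t" for t
      proof -
        have "y \<in> F (s + max 0 t)"
          unfolding x(2) using x(1) s by (intro F_step) (auto simp: A_def)
        moreover have "t \<le> s + max 0 t"
          using s by linarith
        ultimately show ?thesis
          using F_mono by blast
      qed
      then show "y \<in> A" by (simp add: A_def)
    qed
  next
    show "A \<subseteq> S s ` A"
    proof
      fix y assume y: "y \<in> A"
      \<comment> \<open>The preimages of \<open>y\<close> in the images of \<open>B\<close> are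
        again nested, compact and nonempty; a common point is a preimage lying in
        \<open>A\<close>.\<close>
      define K where "K t = F t \<inter> {x \<in> F 0. S s x = y}" for t
      have "closed {x \<in> F 0. S s x = y}"
        using continuous_closed_preimage_constant[of "F 0" "S s" y] cont[OF s] \<open>F 0 \<subseteq> B\<close> F_compact[of 0]
        by (auto intro: continuous_on_subset compact_imp_closed)
      then have "compact (K t)" for t
        unfolding K_def using F_compact by (intro compact_Int_closed)
      moreover have "K t \<noteq> {}" for t
      proof -
        have "y \<in> F (s + max 0 t)"
          using y by (simp add: A_def)
        then obtain b where b: "b \<in> B" "y = S (s + max 0 t) b"
          using s unfolding F_def by auto
        then have "y = S s (S (max 0 t) b)"
          using semigroup s by simp
        moreover have "S (max 0 t) b \<in> F t"
          using b by (simp add: F_def)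
        moreover have "S (max 0 t) b \<in> F 0"
        proof -
          have "S (max 0 t) b \<in> F (max 0 t)"
            using b by (simp add: F_def)
          then show ?thesis
            using F_mono[of 0 "max 0 t"] by auto
        qed
        ultimately show ?thesis
          unfolding K_def by blast
      qed
      moreover have "K t \<subseteq> K r" if "r \<le> t" for r t
        unfolding K_def using F_mono[OF that] by blast
      ultimately have "\<Inter>(range K) \<noteq> {}"
        by (intro compact_nest)
      then obtain x where "\<And>t. x \<in> K t" by blast
      then have "x \<in> A" "S s x = y"
        by (auto simp: K_def A_def)
      then show "y \<in> S s ` A" by blast
    qed
  qed
  have near: "\<exists>t\<ge>0. \<forall>x\<in>B. \<exists>a\<in>A. dist (S t x) a < e" if "e > 0" for e
  proof -
    define N where "N = (\<Union>a\<in>A. ball a e)"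
    have "\<exists>t. F t \<subseteq> N"
    proof (rule ccontr)
      assume *: "\<not> (\<exists>t. F t \<subseteq> N)"
      have "open N" by (auto simp: N_def)
      \<comment> \<open>If no image entered the neighbourhood \<open>N\<close> of \<open>A\<close>,
        the parts outside \<open>N\<close> would share a point, which would lie in \<open>A\<close>
        but not in \<open>N\<close>.\<close>
      have "\<Inter>(range (\<lambda>t. F t - N)) \<noteq> {}"
      proof (rule compact_nest)
        show "compact (F t - N)" for t
          using F_compact \<open>open N\<close> by (simp add: compact_diff)
        show "F t - N \<noteq> {}" for t
          using * by auto
        show "F t - N \<subseteq> F s - N" if "s \<le> t" for s t
          using F_mono[OF that] by blast
      qed
      then obtain x where "x \<in> A" "x \<notin> N"
        unfolding A_def by blast
      then show False
        using \<open>e > 0\<close> unfolding N_def by force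
    qed
    then obtain t where t: "F t \<subseteq> N" by blast
    have "\<exists>a\<in>A. dist (S (max 0 t) x) a < e" if "x \<in> B" for x
    proof -
      have "S (max 0 t) x \<in> N"
        using t that unfolding F_def by blast
      then show ?thesis
        unfolding N_def by (auto simp: dist_commute)
    qed
    then show ?thesis
      by (intro exI[of _ "max 0 t"]) simp
  qed
  have "((\<lambda>t. semidist (S t ` D) A) \<longlongrightarrow> 0) at_top" if D: "bounded D" for D
  proof (rule tendsto_0_ennrealI)
    fix e :: real assume "e > 0"
    then obtain s where s: "s \<ge> 0" "\<forall>x\<in>B. \<exists>a\<in>A. dist (S s x) a < e"
      using near by blast
    obtain r where r: "r \<ge> 0" "S r ` D \<subseteq> B"
      using absorbing[OF D] by blast
    show "eventually (\<lambda>t. semidist (S t ` D) A \<le> ennreal e) at_top"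
      using eventually_ge_at_top[of "s + r"]
    proof eventually_elim
      case (elim t)
      show ?case
      proof (rule semidist_le)
        fix y assume "y \<in> S t ` D"
        then obtain x where x: "x \<in> D" "y = S t x" by blast
        \<comment> \<open>Time \<open>r\<close> brings \<open>D\<close> into \<open>B\<close>, the
          middle stretch stays in \<open>B\<close>, and the last \<open>s\<close> leads close to
          \<open>A\<close>.\<close>
        have "S t x = S (s + (t - s - r) + r) x" by simp
        also have "\<dots> = S s (S (t - s - r) (S r x))"
          using s(1) r(1) elim semigroup[of s "t - s - r"] semigroup[of "s + (t - s - r)" r] by simp
        finally have "y = S s (S (t - s - r) (S r x))"
          using x by simp
        moreover have "S (t - s - r) (S r x) \<in> B"
          using inv[of "t - s - r"] elim r x by auto
        ultimately show "\<exists>a\<in>A. dist y a \<le> e"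
          using s(2) by (metis less_imp_le)
      qed
    qed
  qed
  then have "global_attractor S A"
    unfolding global_attractor_def using \<open>compact A\<close> invariant by blast
  with near show ?thesis by blast
qed

section \<open>Bounds for the lattice flow and its dependence on initial value and driver\<close>

context lattice_model
begin

definition flow :: "(real \<Rightarrow> real) \<Rightarrow> real \<Rightarrow> real ^ 'n \<Rightarrow> real ^ 'n" where
  "flow y = solution_at (\<lambda>t. field (y t))"

text \<open>The 4 is the factor 2 from the pullback estimate times the bound 2 for
  \<open>exp (2 * \<epsilon> * C)\<close>; the 1 is room for the decayed initial value.\<close>

definition absorbing_radius :: real where
  "absorbing_radius = sqrt (4 * (energy / gap) + 1)"

lemma flow_0:
  assumes "continuous_on {0..} y"
  shows "flow y 0 x = x"
  unfolding flow_def by (rule coercive_ode.solution_at_0[OF coercive_ode_field[OF assms]])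

lemma flow_has_derivative:
  assumes "continuous_on {0..} y" "t \<in> {0..T}"
  shows "((\<lambda>t. flow y t x) has_vector_derivative field (y t) (flow y t x)) (at t within {0..T})"
  unfolding flow_def
  by (rule coercive_ode.solution_at_has_derivative[OF coercive_ode_field[OF assms(1)] assms(2)])

lemma norm_flow_has_derivative:
  assumes "continuous_on {0..} y" "t \<in> {0..T}"
  shows "((\<lambda>t. (norm (flow y t x))\<^sup>2) has_vector_derivative
    2 * (flow y t x \<bullet> field (y t) (flow y t x))) (at t within {0..T})"
  by (intro has_vector_derivative_inner_self flow_has_derivative assms)

text \<open>Deliberately crude: it only has to confine all trajectories on a finite horizon to one
  ball, uniformly over drivers with \<open>|y| \<le> 1\<close>.\<close>

lemma norm_flow_growth:
  assumes y: "continuous_on {0..} y" "\<And>s. s \<in> {0..T} \<Longrightarrow> \<bar>y s\<bar> \<le> 1" and t: "t \<in> {0..T}"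
  shows "(norm (flow y t x))\<^sup>2 \<le> exp (2 * t) * ((norm x)\<^sup>2 + exp 2 * energy)"
proof -
  define c where "c = exp 2 * energy"
  have "c \<ge> 0" using energy_pos by (simp add: c_def)
  have "(norm (flow y t x))\<^sup>2 + c \<le> exp (2 * t) * ((norm (flow y 0 x))\<^sup>2 + c)"
  proof (rule differential_gronwall[OF _ _ t])
    fix s assume s: "s \<in> {0..T}"
    let ?u = "flow y s x"
    show "((\<lambda>s. (norm (flow y s x))\<^sup>2 + c) has_vector_derivative 2 * (?u \<bullet> field (y s) ?u)) (at s within {0..T})"
      unfolding has_vector_derivative_add_const by (rule norm_flow_has_derivative[OF y(1) s])
    have "2 * (?u \<bullet> field (y s) ?u) \<le> - gap * (norm ?u)\<^sup>2 + energy * exp (2 * \<bar>y s\<bar>)"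
      by (rule field_energy_le)
    also have "\<dots> \<le> 2 * (norm ?u)\<^sup>2 + energy * exp 2"
      using y(2)[OF s] gap_pos energy_pos by (intro add_mono mult_right_mono mult_left_mono) auto
    also have "\<dots> \<le> 2 * ((norm ?u)\<^sup>2 + c)"
      using energy_pos by (simp add: c_def)
    finally show "2 * (?u \<bullet> field (y s) ?u) \<le> 2 * ((norm ?u)\<^sup>2 + c)" .
  qed
  then show ?thesis
    using \<open>c \<ge> 0\<close> by (simp add: flow_0[OF y(1)] c_def)
qed

lemma norm_flow_autonomous:
  assumes "t \<ge> 0"
  shows "(norm (flow (\<lambda>_. 0) t x))\<^sup>2 - energy / gap
    \<le> exp (- gap * t) * ((norm x)\<^sup>2 - energy / gap)"
proof -
  define c where "c = energy / gap"
  have "(norm (flow (\<lambda>_. 0) t x))\<^sup>2 - c \<le> exp (- gap * t) * ((norm (flow (\<lambda>_. 0) 0 x))\<^sup>2 - c)"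
  proof (rule differential_gronwall[where T = t])
    fix s assume s: "s \<in> {0..t}"
    let ?u = "flow (\<lambda>_. 0) s x"
    show "((\<lambda>s. (norm (flow (\<lambda>_. 0) s x))\<^sup>2 - c) has_vector_derivative 2 * (?u \<bullet> field 0 ?u)) (at s within {0..t})"
      unfolding diff_conv_add_uminus has_vector_derivative_add_const
      by (rule norm_flow_has_derivative[OF continuous_on_const s])
    show "2 * (?u \<bullet> field 0 ?u) \<le> - gap * ((norm ?u)\<^sup>2 - c)"
      using field_energy_le[of ?u 0] gap_pos
      by (simp add: c_def algebra_simps)
  qed (use assms in auto)
  then show ?thesis
    by (simp add: flow_0 c_def)
qed

text \<open>The constant \<open>K\<close> is fixed before \<eta>, so the estimate serves twice:
  equal initial values give closeness of the flows, the zero driver gives continuity in the initial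
  value.\<close>

lemma flow_distance:
  assumes "T \<ge> 0"
  shows "\<exists>K>0. \<forall>\<eta>>0. \<exists>d>0. \<forall>y. continuous_on {0..} y \<longrightarrow> (\<forall>s\<in>{0..T}. \<bar>y s\<bar> \<le> d) \<longrightarrow>
    (\<forall>x\<in>cball 0 R. \<forall>x'\<in>cball 0 R.
      (norm (flow y T x - flow (\<lambda>_. 0) T x'))\<^sup>2 \<le> K * ((norm (x - x'))\<^sup>2 + \<eta>\<^sup>2))"
proof -
  define R1 where "R1 = sqrt (exp (2 * T) * (R\<^sup>2 + exp 2 * energy))"
  have bd: "flow y t x \<in> cball 0 R1"
    if y: "continuous_on {0..} y" "\<And>s. s \<in> {0..T} \<Longrightarrow> \<bar>y s\<bar> \<le> 1" and t: "t \<in> {0..T}"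
      and x: "x \<in> cball 0 R" for y t x
  proof -
    have "(norm x)\<^sup>2 \<le> R\<^sup>2"
      using x by (intro power_mono) auto
    have "(norm (flow y t x))\<^sup>2 \<le> exp (2 * t) * ((norm x)\<^sup>2 + exp 2 * energy)"
      by (rule norm_flow_growth[OF y t])
    also have "\<dots> \<le> exp (2 * T) * (R\<^sup>2 + exp 2 * energy)"
      using t energy_pos \<open>(norm x)\<^sup>2 \<le> R\<^sup>2\<close> by (intro mult_mono add_mono) auto
    finally show ?thesis
      unfolding R1_def by (simp add: real_le_rsqrt)
  qed
  obtain L where "L \<ge> 0" and L: "\<And>u v. u \<in> cball 0 R1 \<Longrightarrow> v \<in> cball 0 R1 \<Longrightarrow>
      norm (field 0 u - field 0 v) \<le> L * norm (u - v)"
  proof -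
    obtain L where "L \<ge> 0" "\<forall>y\<in>{-1..1}. \<forall>u\<in>cball 0 R1. \<forall>v\<in>cball 0 R1.
        norm (field y u - field y v) \<le> L * norm (u - v)"
      using loc_lip_cocycle_field unfolding loc_lip_def by blast
    then show ?thesis
      using that[of L] by simp
  qed
  show ?thesis
  proof (rule exI[of _ "exp ((2 * L + 1) * T)"], intro conjI allI impI)
    fix \<eta> :: real assume "\<eta> > 0"
    have "continuous_on UNIV (\<lambda>(y, u). field y u)"
      using loc_lip_cocycle_field unfolding loc_lip_def by blast
    then have "continuous_on ({-1..1} \<times> cball 0 R1) (\<lambda>(y, u). field y u)"
      by (rule continuous_on_subset) simp
    \<comment> \<open>Uniform continuity on the compact set bounds the change of the field due to
      \<open>y\<close> uniformly in \<open>u\<close>, which supplies the defect \<eta> for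
      Gronwall.\<close>
    then have "uniformly_continuous_on ({-1..1} \<times> cball 0 R1) (\<lambda>(y, u). field y u)"
      by (intro compact_uniformly_continuous compact_Times) auto
    then obtain d where "d > 0" and d: "\<And>p q. p \<in> {-1..1} \<times> cball 0 R1 \<Longrightarrow> q \<in> {-1..1} \<times> cball 0 R1 \<Longrightarrow>
        dist q p < d \<Longrightarrow> dist (case q of (y, u) \<Rightarrow> field y u) (case p of (y, u) \<Rightarrow> field y u) < \<eta>"
      using \<open>\<eta> > 0\<close> unfolding uniformly_continuous_on_def by metis
    have field_near: "norm (field y u - field 0 u) \<le> \<eta>" if "\<bar>y\<bar> \<le> min 1 (d / 2)" "u \<in> cball 0 R1" for y u
      using d[of "(0, u)" "(y, u)"] that \<open>d > 0\<close> by (simp add: dist_Pair_Pair dist_norm abs_le_iff)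
    show "\<exists>d>0. \<forall>y. continuous_on {0..} y \<longrightarrow> (\<forall>s\<in>{0..T}. \<bar>y s\<bar> \<le> d) \<longrightarrow>
      (\<forall>x\<in>cball 0 R. \<forall>x'\<in>cball 0 R. (norm (flow y T x - flow (\<lambda>_. 0) T x'))\<^sup>2
        \<le> exp ((2 * L + 1) * T) * ((norm (x - x'))\<^sup>2 + \<eta>\<^sup>2))"
    proof (intro exI[of _ "min 1 (d / 2)"] conjI allI impI ballI)
      fix y and x x' :: "real ^ 'n"
      assume y: "continuous_on {0..} y" "\<forall>s\<in>{0..T}. \<bar>y s\<bar> \<le> min 1 (d / 2)"
        and x: "x \<in> cball 0 R" and x': "x' \<in> cball 0 R"
      let ?u = "\<lambda>t. flow y t x" and ?v = "\<lambda>t. flow (\<lambda>_. 0) t x'"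
      have "(norm (?u T - ?v T))\<^sup>2 \<le> exp ((2 * L + 1) * T) * ((norm (?u 0 - ?v 0))\<^sup>2 + \<eta>\<^sup>2)"
      proof (rule gronwall_distance)
        fix t assume t: "t \<in> {0..T}"
        show "(?u has_vector_derivative field (y t) (?u t)) (at t within {0..T})"
          by (rule flow_has_derivative[OF y(1) t])
        show "(?v has_vector_derivative field 0 (?v t)) (at t within {0..T})"
          by (rule flow_has_derivative[OF continuous_on_const t])
        have u: "?u t \<in> cball 0 R1" and v: "?v t \<in> cball 0 R1"
          using y by (intro bd t x x'; simp)+
        have "norm (field (y t) (?u t) - field 0 (?v t))
            \<le> norm (field (y t) (?u t) - field 0 (?u t)) + norm (field 0 (?u t) - field 0 (?v t))"
          using dist_triangle[of "field (y t) (?u t)" "field 0 (?v t)" "field 0 (?u t)"]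
          by (simp add: dist_norm)
        also have "\<dots> \<le> \<eta> + L * norm (?u t - ?v t)"
          using y(2) t by (intro add_mono field_near L u v) blast
        finally show "norm (field (y t) (?u t) - field 0 (?v t)) \<le> L * norm (?u t - ?v t) + \<eta>"
          by simp
      qed (use \<open>L \<ge> 0\<close> \<open>T \<ge> 0\<close> in auto)
      then show "(norm (?u T - ?v T))\<^sup>2 \<le> exp ((2 * L + 1) * T) * ((norm (x - x'))\<^sup>2 + \<eta>\<^sup>2)"
        using y(1) by (simp add: flow_0)
    qed (use \<open>d > 0\<close> in auto)
  qed simp
qed

lemma flow_comparison:
  assumes "T \<ge> 0" "e > 0"
  shows "\<exists>d>0. \<forall>y. continuous_on {0..} y \<longrightarrow> (\<forall>s\<in>{0..T}. \<bar>y s\<bar> \<le> d) \<longrightarrow>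
    (\<forall>x\<in>cball 0 R. norm (flow y T x - flow (\<lambda>_. 0) T x) \<le> e)"
proof -
  obtain K where "K > 0" and K: "\<And>\<eta>. \<eta> > 0 \<Longrightarrow> \<exists>d>0. \<forall>y. continuous_on {0..} y \<longrightarrow> (\<forall>s\<in>{0..T}. \<bar>y s\<bar> \<le> d) \<longrightarrow>
    (\<forall>x\<in>cball 0 R. \<forall>x'\<in>cball 0 R.
      (norm (flow y T x - flow (\<lambda>_. 0) T x'))\<^sup>2 \<le> K * ((norm (x - x'))\<^sup>2 + \<eta>\<^sup>2))"
    using flow_distance[OF assms(1), of R] by blast
  have "e / sqrt K > 0" "K * (e / sqrt K)\<^sup>2 = e\<^sup>2"
    using \<open>K > 0\<close> \<open>e > 0\<close> by (auto simp: power_divide)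
  from K[OF this(1)] obtain d where "d > 0" and d: "\<forall>y. continuous_on {0..} y \<longrightarrow>
      (\<forall>s\<in>{0..T}. \<bar>y s\<bar> \<le> d) \<longrightarrow> (\<forall>x\<in>cball 0 R. \<forall>x'\<in>cball 0 R.
      (norm (flow y T x - flow (\<lambda>_. 0) T x'))\<^sup>2 \<le> K * ((norm (x - x'))\<^sup>2 + (e / sqrt K)\<^sup>2))"
    by blast
  show ?thesis
  proof (intro exI[of _ d] conjI allI impI ballI)
    fix y and x :: "real ^ 'n"
    assume "continuous_on {0..} y" "\<forall>s\<in>{0..T}. \<bar>y s\<bar> \<le> d" "x \<in> cball 0 R"
    with d have "(norm (flow y T x - flow (\<lambda>_. 0) T x))\<^sup>2 \<le> K * ((norm (x - x))\<^sup>2 + (e / sqrt K)\<^sup>2)"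
      by blast
    also have "\<dots> = e\<^sup>2"
      using \<open>K * (e / sqrt K)\<^sup>2 = e\<^sup>2\<close> by simp
    finally show "norm (flow y T x - flow (\<lambda>_. 0) T x) \<le> e"
      by (rule power2_le_imp_le) (use \<open>e > 0\<close> in simp)
  qed (rule \<open>d > 0\<close>)
qed

text \<open>Taking \<eta> to be the distance of the two initial values turns the estimate into a
  Lipschitz bound; the zero driver meets every smallness condition.\<close>

lemma continuous_on_flow_autonomous:
  assumes "t \<ge> 0"
  shows "continuous_on (cball 0 R) (flow (\<lambda>_. 0) t)"
proof -
  obtain K where "K > 0" and K: "\<And>\<eta>. \<eta> > 0 \<Longrightarrow> \<exists>d>0. \<forall>y. continuous_on {0..} y \<longrightarrow> (\<forall>s\<in>{0..t}. \<bar>y s\<bar> \<le> d) \<longrightarrow>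
    (\<forall>x\<in>cball 0 R. \<forall>x'\<in>cball 0 R.
      (norm (flow y t x - flow (\<lambda>_. 0) t x'))\<^sup>2 \<le> K * ((norm (x - x'))\<^sup>2 + \<eta>\<^sup>2))"
    using flow_distance[OF assms(1), of R] by blast
  have "norm (flow (\<lambda>_. 0) t x - flow (\<lambda>_. 0) t x') \<le> sqrt (2 * K) * norm (x - x')"
    if x: "x \<in> cball 0 R" "x' \<in> cball 0 R" for x x'
  proof (cases "x = x'")
    case False
    then have "norm (x - x') > 0" by simp
    from K[OF this] obtain d where "d > 0" and d: "\<forall>y. continuous_on {0..} y \<longrightarrow> (\<forall>s\<in>{0..t}. \<bar>y s\<bar> \<le> d) \<longrightarrow>
      (\<forall>z\<in>cball 0 R. \<forall>z'\<in>cball 0 R. (norm (flow y t z - flow (\<lambda>_. 0) t z'))\<^sup>2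
        \<le> K * ((norm (z - z'))\<^sup>2 + (norm (x - x'))\<^sup>2))"
      by blast
    from d[rule_format, OF continuous_on_const _ x] \<open>d > 0\<close>
    have "(norm (flow (\<lambda>_. 0) t x - flow (\<lambda>_. 0) t x'))\<^sup>2 \<le> (sqrt (2 * K) * norm (x - x'))\<^sup>2"
      using \<open>K > 0\<close> by (simp add: power_mult_distrib mult.assoc mult.left_commute)
    then show ?thesis
      by (rule power2_le_imp_le) (use \<open>K > 0\<close> in simp)
  qed simp
  then have "(sqrt (2 * K))-lipschitz_on (cball 0 R) (flow (\<lambda>_. 0) t)"
    using \<open>K > 0\<close> by (intro lipschitz_onI) (auto simp: dist_norm)
  then show ?thesis
    by (rule lipschitz_on_continuous_on)
qed

end

section \<open>The pullback absorbing ball\<close>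

lemma sublinear_bound:
  fixes g :: "real \<Rightarrow> real"
  assumes cont: "continuous_on UNIV g" and lim: "((\<lambda>t. \<bar>g t\<bar> / \<bar>t\<bar>) \<longlongrightarrow> 0) at_bot" and "\<delta> > 0"
  shows "\<exists>C\<ge>0. \<forall>s\<le>0. \<bar>g s\<bar> \<le> C + \<delta> * \<bar>s\<bar>"
proof -
  have "eventually (\<lambda>t. \<bar>g t\<bar> / \<bar>t\<bar> < \<delta>) at_bot"
    using order_tendstoD(2)[OF lim \<open>\<delta> > 0\<close>] .
  then obtain N where N: "\<And>t. t \<le> N \<Longrightarrow> \<bar>g t\<bar> / \<bar>t\<bar> < \<delta>"
    unfolding eventually_at_bot_linorder by blast
  \<comment> \<open>The bound \<open>-1\<close> keeps \<open>|s|\<close> positive where the quotient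
    is multiplied out.\<close>
  define M where "M = min N (-1)"
  have "bounded (g ` {M..0})"
    by (intro compact_imp_bounded compact_continuous_image continuous_on_subset[OF cont]) auto
  then obtain C where "C > 0" and C: "\<And>t. t \<in> {M..0} \<Longrightarrow> \<bar>g t\<bar> \<le> C"
    unfolding bounded_pos by auto
  have "\<bar>g s\<bar> \<le> C + \<delta> * \<bar>s\<bar>" if "s \<le> 0" for s
  proof (cases "s \<ge> M")
    case True
    then have "\<bar>g s\<bar> \<le> C" using C that by simp
    moreover have "0 \<le> \<delta> * \<bar>s\<bar>" using \<open>\<delta> > 0\<close> by simp
    ultimately show ?thesis by linarith
  next
    case False
    then have "s \<le> N" "\<bar>s\<bar> > 0" by (auto simp: M_def)
    then have "\<bar>g s\<bar> < \<delta> * \<bar>s\<bar>"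
      using N[of s] by (simp add: divide_less_eq)
    then show ?thesis using \<open>C > 0\<close> by linarith
  qed
  then show ?thesis using \<open>C > 0\<close> by (intro exI[of _ C]) auto
qed

lemma eventually_at_right_0I:
  fixes b :: real
  assumes "b > 0" "\<And>x. 0 < x \<Longrightarrow> x < b \<Longrightarrow> Q x"
  shows "eventually Q (at_right 0)"
  using assms eventually_at_right_field by blast

context lattice_model
begin

text \<open>The slope \<open>gap / 4\<close> lets \<open>exp (2 * |y|)\<close> grow into the past at
  rate at most \<open>gap / 2\<close>, half the decay rate. The net rate \<open>gap / 2\<close> is
  the source of the factor 2, uniformly in \<open>t\<close>.\<close>

lemma norm_flow_pullback:
  fixes z :: "real \<Rightarrow> real"
  assumes z: "continuous_on UNIV z" and z_le: "\<And>s. s \<le> 0 \<Longrightarrow> \<bar>z s\<bar> \<le> C + gap / 4 * \<bar>s\<bar>"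
    and \<epsilon>: "0 < \<epsilon>" "\<epsilon> \<le> 1" and "t \<ge> 0"
  shows "(norm (flow (\<lambda>s. \<epsilon> * z (s - t)) t x))\<^sup>2
    \<le> exp (- gap * t) * (norm x)\<^sup>2 + 2 * (energy / gap) * exp (2 * \<epsilon> * C)"
proof -
  define y where "y s = \<epsilon> * z (s - t)" for s
  have y: "continuous_on {0..} y"
    unfolding y_def by (intro continuous_intros continuous_on_compose2[OF z]) auto
  define w where "w s = (norm (flow y s x))\<^sup>2" for s
  define E where "E s = exp (gap * (s - t))" for s
  define c where "c = 2 * (energy / gap) * exp (2 * \<epsilon> * C)"
  \<comment> \<open>An antiderivative of the bound on the weighted forcing; \<open>w * E - K\<close>
    is then nonincreasing, which is Gronwall at rate \<open>0\<close>.\<close>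
  define K where "K s = c * exp (gap / 2 * (s - t))" for s
  have "w t * E t - K t \<le> exp (0 * t) * (w 0 * E 0 - K 0)"
  proof (rule differential_gronwall[where T = t])
    fix s assume s: "s \<in> {0..t}"
    let ?u = "flow y s x"
    let ?w' = "2 * (?u \<bullet> field (y s) ?u)"
    have w: "(w has_real_derivative ?w') (at s within {0..t})"
      unfolding w_def has_real_derivative_iff_has_vector_derivative
      by (rule norm_flow_has_derivative[OF y s])
    have E: "(E has_real_derivative E s * gap) (at s within {0..t})"
      unfolding E_def by (auto intro!: derivative_eq_intros)
    have "(K has_real_derivative gap / 2 * K s) (at s within {0..t})"
      unfolding K_def by (auto intro!: derivative_eq_intros)
    with w E show "((\<lambda>s. w s * E s - K s) has_vector_derivative
        ?w' * E s + E s * gap * w s - gap / 2 * K s) (at s within {0..t})"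
      unfolding has_real_derivative_iff_has_vector_derivative[symmetric]
      by (auto intro!: derivative_eq_intros)
    have "E s * exp (2 * \<bar>y s\<bar>) \<le> exp (gap / 2 * (s - t) + 2 * \<epsilon> * C)"
    proof -
      have s': "s - t \<le> 0" "\<bar>s - t\<bar> = t - s" using s by auto
      have "\<bar>y s\<bar> \<le> \<epsilon> * (C + gap / 4 * (t - s))"
        using z_le[OF s'(1)] \<epsilon> unfolding y_def s'(2) abs_mult by (intro mult_mono) auto
      also have "\<dots> = \<epsilon> * C + \<epsilon> * (gap / 4 * (t - s))"
        by (simp add: distrib_left)
      \<comment> \<open>The factor \<epsilon> is given up on the slope but kept on \<open>C\<close>,
        so small \<epsilon> can tame the path-dependent constant.\<close>
      also have "\<dots> \<le> \<epsilon> * C + 1 * (gap / 4 * (t - s))"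
        using \<epsilon> gap_pos s by (intro add_left_mono mult_right_mono) auto
      finally show ?thesis
        unfolding E_def exp_add[symmetric] by (simp add: field_simps)
    qed
    then have "E s * exp (2 * \<bar>y s\<bar>) * energy \<le> exp (gap / 2 * (s - t) + 2 * \<epsilon> * C) * energy"
      using energy_pos by (intro mult_right_mono) auto
    also have "\<dots> = gap / 2 * K s"
      using gap_pos by (simp add: K_def c_def exp_add)
    finally have EK: "E s * exp (2 * \<bar>y s\<bar>) * energy \<le> gap / 2 * K s" .
    have "?w' * E s \<le> (- gap * w s + energy * exp (2 * \<bar>y s\<bar>)) * E s"
      unfolding w_def by (intro mult_right_mono field_energy_le) (simp add: E_def)
    also have "\<dots> = - (E s * gap * w s) + E s * exp (2 * \<bar>y s\<bar>) * energy"
      by (simp add: algebra_simps)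
    finally show "?w' * E s + E s * gap * w s - gap / 2 * K s \<le> 0 * (w s * E s - K s)"
      using EK by linarith
  qed (use \<open>t \<ge> 0\<close> in auto)
  then have "w t * E t \<le> w 0 * E 0 + K t - K 0" by simp
  moreover have "K 0 \<ge> 0"
    using energy_pos gap_pos by (simp add: K_def c_def)
  moreover have "E t = 1" "K t = c" "w 0 = (norm x)\<^sup>2" "E 0 = exp (- gap * t)"
    using flow_0[OF y] by (simp_all add: E_def K_def w_def)
  ultimately have "w t \<le> exp (- gap * t) * (norm x)\<^sup>2 + c"
    by (simp add: mult.commute)
  then show ?thesis
    unfolding w_def c_def y_def .
qed

lemma lattice_semigroup_flow: "lattice_semigroup \<alpha> \<beta> \<nu> lam \<gamma> f ix = flow (\<lambda>_. 0)"
  by (simp add: lattice_semigroup_def flow_def cocycle_field_0)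

lemma lattice_cocycle_flow:
  "lattice_cocycle \<alpha> \<beta> \<nu> lam \<gamma> f ix \<epsilon> t \<omega> = flow (\<lambda>s. \<epsilon> * ou (shift s \<omega>)) t"
  by (simp add: lattice_cocycle_def flow_def)

lemma absorbing_radius_pos: "absorbing_radius > 0"
  unfolding absorbing_radius_def using energy_pos gap_pos by (simp add: add_nonneg_pos)

lemma absorbing_radius_power2: "absorbing_radius\<^sup>2 = 4 * (energy / gap) + 1"
  unfolding absorbing_radius_def using energy_pos gap_pos by simp

lemma lattice_semigroup_attractor:
  "\<exists>A. global_attractor (lattice_semigroup \<alpha> \<beta> \<nu> lam \<gamma> f ix) A \<and>
    (\<forall>e>0. \<exists>t\<ge>0. \<forall>x\<in>cball 0 absorbing_radius. \<exists>a\<in>A. dist (flow (\<lambda>_. 0) t x) a < e)"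
  unfolding lattice_semigroup_flow
proof (rule global_attractor_of_absorbing)
  let ?B = "cball (0 :: real ^ 'n) absorbing_radius"
  define c where "c = energy / gap"
  have "c > 0" using energy_pos gap_pos by (simp add: c_def)
  have in_ball: "x \<in> ?B" if "(norm x)\<^sup>2 \<le> 4 * c + 1" for x :: "real ^ 'n"
    using that absorbing_radius_pos unfolding c_def absorbing_radius_power2[symmetric]
    by (auto intro: power2_le_imp_le)
  have decay: "(norm (flow (\<lambda>_. 0) t x))\<^sup>2 \<le> c + exp (- gap * t) * (norm x)\<^sup>2" if "t \<ge> 0" for t x
  proof -
    have "0 \<le> exp (- gap * t) * c" using \<open>c > 0\<close> by simp
    then show ?thesis
      using norm_flow_autonomous[OF that, of x] unfolding c_def right_diff_distrib by linarith
  qed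
  show "compact ?B" "?B \<noteq> {}"
    using absorbing_radius_pos by auto
  show "continuous_on ?B (flow (\<lambda>_. 0) t)" if "t \<ge> 0" for t
    by (rule continuous_on_flow_autonomous[OF that])
  show "flow (\<lambda>_. 0) (s + t) x = flow (\<lambda>_. 0) s (flow (\<lambda>_. 0) t x)" if "s \<ge> 0" "t \<ge> 0" for s t x
    unfolding flow_def
    by (rule solution_at_semigroup[OF coercive_ode_field[OF continuous_on_const] that])
  show "flow (\<lambda>_. 0) t ` ?B \<subseteq> ?B" if "t \<ge> 0" for t
  proof (rule image_subsetI)
    fix x assume "x \<in> ?B"
    then have "(norm x)\<^sup>2 \<le> 4 * c + 1"
      unfolding c_def absorbing_radius_power2[symmetric] by (intro power_mono) auto
    then have "(norm x)\<^sup>2 - c \<le> 3 * c + 1" by simp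
    then have "exp (- gap * t) * ((norm x)\<^sup>2 - c) \<le> exp (- gap * t) * (3 * c + 1)"
      by (intro mult_left_mono) auto
    also have "\<dots> \<le> 1 * (3 * c + 1)"
      using gap_pos that \<open>c > 0\<close> by (intro mult_right_mono) auto
    finally show "flow (\<lambda>_. 0) t x \<in> ?B"
      using norm_flow_autonomous[OF that, of x] by (intro in_ball) (simp add: c_def)
  qed
  show "\<exists>t\<ge>0. flow (\<lambda>_. 0) t ` D \<subseteq> ?B" if D: "bounded D" for D
  proof -
    obtain b where "b > 0" and b: "\<And>x. x \<in> D \<Longrightarrow> norm x \<le> b"
      using D unfolding bounded_pos by blast
    have "((\<lambda>t. exp (- gap * t) * b\<^sup>2) \<longlongrightarrow> 0) at_top"
      using gap_pos by real_asymp
    then have "eventually (\<lambda>t. exp (- gap * t) * b\<^sup>2 < 1) at_top"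
      by (rule order_tendstoD) simp
    then have "eventually (\<lambda>t. exp (- gap * t) * b\<^sup>2 < 1 \<and> t \<ge> 0) at_top"
      using eventually_ge_at_top by (rule eventually_conj)
    then obtain t where t: "t \<ge> 0" "exp (- gap * t) * b\<^sup>2 < 1"
      unfolding eventually_at_top_linorder by blast
    have "flow (\<lambda>_. 0) t x \<in> ?B" if "x \<in> D" for x
    proof (rule in_ball)
      have "exp (- gap * t) * (norm x)\<^sup>2 \<le> exp (- gap * t) * b\<^sup>2"
        using b[OF that] by (intro mult_left_mono power_mono) auto
      then show "(norm (flow (\<lambda>_. 0) t x))\<^sup>2 \<le> 4 * c + 1"
        using decay[OF t(1), of x] t(2) \<open>c > 0\<close> by linarith
    qed
    then show ?thesis using t(1) by blast
  qed
qed

end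

section \<open>Shifted paths and convergence of the random attractors\<close>

lemma shift_add:
  "shift s (shift t \<omega>) = shift (t + s) \<omega>"
  by (simp add: shift_def fun_eq_iff add_ac)

lemma shift_path_0: "\<omega> \<in> path_space \<Longrightarrow> shift 0 \<omega> = \<omega>"
  by (simp add: shift_def path_space_def fun_eq_iff)

lemma admissible_paths_shift:
  assumes "admissible_paths P \<Omega>" "\<omega> \<in> \<Omega>"
  shows "shift t \<omega> \<in> \<Omega>"
proof -
  have "shift t ` \<Omega> = \<Omega>"
    using assms unfolding admissible_paths_def by blast
  then show ?thesis using \<open>\<omega> \<in> \<Omega>\<close> by blast
qed

context lattice_model
begin

text \<open>By invariance a point of the attractor has a preimage arbitrarily far in the past, and
  the pullback time may be chosen after \<epsilon>. Temperedness then makes the initial value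
  negligible, while the threshold for \<epsilon> depends on the path through
  \<open>C\<close>.\<close>

lemma random_attractor_in_ball:
  assumes adm: "admissible_paths P \<Omega>" and \<omega>: "\<omega> \<in> \<Omega>" and "b > 0"
    and attr: "\<And>\<epsilon>. 0 < \<epsilon> \<Longrightarrow> \<epsilon> \<le> b \<Longrightarrow>
      random_attractor P \<Omega> (lattice_cocycle \<alpha> \<beta> \<nu> lam \<gamma> f ix \<epsilon>) (A \<epsilon>)"
  shows "eventually (\<lambda>\<epsilon>. A \<epsilon> \<omega> \<subseteq> cball 0 absorbing_radius) (at_right 0)"
proof -
  define z where "z = (\<lambda>t. ou (shift t \<omega>))"
  note shift_\<Omega> = admissible_paths_shift[OF adm \<omega>]
  have "\<omega> \<in> path_space"
    using adm \<omega> unfolding admissible_paths_def by blast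
  note paths = adm[unfolded admissible_paths_def, THEN conjunct2, THEN conjunct2, THEN conjunct2,
      THEN bspec, OF \<omega>]
  have z: "continuous_on UNIV z" and z_lim: "((\<lambda>t. \<bar>z t\<bar> / \<bar>t\<bar>) \<longlongrightarrow> 0) at_bot"
    unfolding z_def using paths by simp_all
  obtain C where "C \<ge> 0" and C: "\<And>s. s \<le> 0 \<Longrightarrow> \<bar>z s\<bar> \<le> C + gap / 4 * \<bar>s\<bar>"
    using sublinear_bound[OF z z_lim, of "gap / 4"] gap_pos by auto
  \<comment> \<open>The last entry ensures \<open>exp (2 * \<epsilon> * C) \<le> 2\<close>; the
    summand 1 avoids a zero denominator.\<close>
  define b' where "b' = min b (min 1 (ln 2 / (2 * C + 1)))"
  have "A \<epsilon> \<omega> \<subseteq> cball 0 absorbing_radius" if \<epsilon>: "0 < \<epsilon>" "\<epsilon> < b'" for \<epsilon>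
  proof
    fix x assume x: "x \<in> A \<epsilon> \<omega>"
    have "\<epsilon> \<le> b" "\<epsilon> \<le> 1" "\<epsilon> < ln 2 / (2 * C + 1)"
      using \<epsilon> by (auto simp: b'_def)
    then have "2 * \<epsilon> * C \<le> ln 2"
      using \<open>C \<ge> 0\<close> \<epsilon>(1) by (simp add: less_divide_eq algebra_simps)
    then have "exp (2 * \<epsilon> * C) \<le> 2"
      using exp_le_cancel_iff[of "2 * \<epsilon> * C" "ln 2"] by simp
    have A: "random_attractor P \<Omega> (lattice_cocycle \<alpha> \<beta> \<nu> lam \<gamma> f ix \<epsilon>) (A \<epsilon>)"
      using attr \<epsilon>(1) \<open>\<epsilon> \<le> b\<close> by blast
    have "\<forall>\<rho>>0. \<forall>\<omega>\<in>\<Omega>. ((\<lambda>t. ennreal (exp (- \<rho> * t)) * (SUP x\<in>A \<epsilon> (shift (- t) \<omega>). ennreal (norm x)))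
        \<longlongrightarrow> 0) at_top"
      using A unfolding random_attractor_def tempered_universe_def by blast
    \<comment> \<open>At tempering rate \<open>gap / 4\<close> the square of the initial norm is at
      most \<open>exp (gap / 2 * t)\<close>, which the decay \<open>exp (- gap * t)\<close>
      beats.\<close>
    with \<omega> gap_pos have "((\<lambda>t. ennreal (exp (- (gap / 4) * t)) *
        (SUP x\<in>A \<epsilon> (shift (- t) \<omega>). ennreal (norm x))) \<longlongrightarrow> 0) at_top"
      by (meson divide_pos_pos zero_less_numeral)
    then have "eventually (\<lambda>t. ennreal (exp (- (gap / 4) * t)) *
        (SUP x\<in>A \<epsilon> (shift (- t) \<omega>). ennreal (norm x)) < 1) at_top"
      by (rule order_tendstoD) simp
    moreover have "((\<lambda>t. exp (- (gap / 2) * t)) \<longlongrightarrow> 0) at_top"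
      using gap_pos by real_asymp
    then have "eventually (\<lambda>t. exp (- (gap / 2) * t) < 1) at_top"
      by (rule order_tendstoD) simp
    ultimately have "eventually (\<lambda>t. ennreal (exp (- (gap / 4) * t)) *
        (SUP x\<in>A \<epsilon> (shift (- t) \<omega>). ennreal (norm x)) < 1 \<and>
        exp (- (gap / 2) * t) < 1 \<and> t \<ge> 0) at_top"
      using eventually_ge_at_top[of 0] by eventually_elim auto
    then obtain t where t: "t \<ge> 0" "exp (- (gap / 2) * t) < 1"
      and sup: "ennreal (exp (- (gap / 4) * t)) * (SUP x\<in>A \<epsilon> (shift (- t) \<omega>). ennreal (norm x)) < 1"
      unfolding eventually_at_top_linorder by blast
    have "lattice_cocycle \<alpha> \<beta> \<nu> lam \<gamma> f ix \<epsilon> t (shift (- t) \<omega>) ` A \<epsilon> (shift (- t) \<omega>)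
        = A \<epsilon> (shift t (shift (- t) \<omega>))"
      using A shift_\<Omega> t(1) unfolding random_attractor_def by blast
    also have "shift t (shift (- t) \<omega>) = \<omega>"
      using shift_path_0[OF \<open>\<omega> \<in> path_space\<close>] by (simp add: shift_add)
    finally obtain x' where x': "x' \<in> A \<epsilon> (shift (- t) \<omega>)"
      and "x = lattice_cocycle \<alpha> \<beta> \<nu> lam \<gamma> f ix \<epsilon> t (shift (- t) \<omega>) x'"
      using x by blast
    then have x_eq: "x = flow (\<lambda>s. \<epsilon> * z (s - t)) t x'"
      by (simp add: lattice_cocycle_flow shift_add z_def)
    have "ennreal (exp (- (gap / 4) * t) * norm x')
        \<le> ennreal (exp (- (gap / 4) * t)) * (SUP x\<in>A \<epsilon> (shift (- t) \<omega>). ennreal (norm x))"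
      using x' by (subst ennreal_mult) (auto intro!: mult_left_mono SUP_upper)
    also note sup
    finally have "exp (- (gap / 4) * t) * norm x' < 1"
      by (simp only: ennreal_less_one_iff)
    then have "norm x' < exp (gap / 4 * t)"
      by (simp add: exp_minus field_simps)
    then have x'_le: "(norm x')\<^sup>2 \<le> exp (gap / 2 * t)"
      using power_mono[of "norm x'" "exp (gap / 4 * t)" 2] by (simp add: mult.commute flip: exp_double)
    have "(norm x)\<^sup>2 \<le> exp (- gap * t) * (norm x')\<^sup>2 + 2 * (energy / gap) * exp (2 * \<epsilon> * C)"
      unfolding x_eq by (rule norm_flow_pullback[OF z C \<epsilon>(1) \<open>\<epsilon> \<le> 1\<close> t(1)])
    also have "\<dots> \<le> exp (- gap * t) * exp (gap / 2 * t) + 2 * (energy / gap) * 2"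
      using x'_le \<open>exp (2 * \<epsilon> * C) \<le> 2\<close> energy_pos gap_pos by (intro add_mono mult_left_mono) auto
    also have "exp (- gap * t) * exp (gap / 2 * t) = exp (- (gap / 2) * t)"
      by (simp add: field_simps flip: exp_add)
    also have "\<dots> + 2 * (energy / gap) * 2 \<le> absorbing_radius\<^sup>2"
      using t(2) by (simp add: absorbing_radius_power2)
    finally show "x \<in> cball 0 absorbing_radius"
      using absorbing_radius_pos by (auto intro: power2_le_imp_le)
  qed
  moreover have "b' > 0"
    using \<open>b > 0\<close> \<open>C \<ge> 0\<close> by (simp add: b'_def)
  ultimately show ?thesis
    by (intro eventually_at_right_0I[of b'])
qed

lemma random_attractor_upper_semicontinuous:
  assumes adm: "admissible_paths P \<Omega>" and \<omega>: "\<omega> \<in> \<Omega>" and "b > 0"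
    and attr: "\<And>\<epsilon>. 0 < \<epsilon> \<Longrightarrow> \<epsilon> \<le> b \<Longrightarrow>
      random_attractor P \<Omega> (lattice_cocycle \<alpha> \<beta> \<nu> lam \<gamma> f ix \<epsilon>) (A\<epsilon> \<epsilon>)"
    and near: "\<And>e. e > 0 \<Longrightarrow> \<exists>t\<ge>0. \<forall>x\<in>cball 0 absorbing_radius. \<exists>a\<in>A. dist (flow (\<lambda>_. 0) t x) a < e"
  shows "((\<lambda>\<epsilon>. semidist (A\<epsilon> \<epsilon> \<omega>) A) \<longlongrightarrow> 0) (at_right 0)"
proof (rule tendsto_0_ennrealI)
  fix e :: real assume "e > 0"
  then obtain t where "t \<ge> 0"
    and t: "\<And>x. x \<in> cball 0 absorbing_radius \<Longrightarrow> \<exists>a\<in>A. dist (flow (\<lambda>_. 0) t x) a < e / 2"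
    using near[of "e / 2"] by auto
  obtain d where "d > 0" and d: "\<forall>y. continuous_on {0..} y \<longrightarrow> (\<forall>s\<in>{0..t}. \<bar>y s\<bar> \<le> d) \<longrightarrow>
      (\<forall>x\<in>cball 0 absorbing_radius. norm (flow y t x - flow (\<lambda>_. 0) t x) \<le> e / 2)"
    using flow_comparison[OF \<open>t \<ge> 0\<close>, of "e / 2"] \<open>e > 0\<close> half_gt_zero by blast
  \<comment> \<open>The ball inclusion is needed at this path, where the evolution over time
    \<open>t\<close> starts; it is fixed before \<epsilon> is made small.\<close>
  define \<omega>' where "\<omega>' = shift (- t) \<omega>"
  have "\<omega> \<in> path_space"
    using adm \<omega> unfolding admissible_paths_def by blast
  moreover have "\<omega>' \<in> \<Omega>"
    unfolding \<omega>'_def by (rule admissible_paths_shift[OF adm \<omega>])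
  ultimately have shift_\<omega>': "shift t \<omega>' = \<omega>"
    by (simp add: \<omega>'_def shift_add shift_path_0)
  define z where "z = (\<lambda>s. ou (shift s \<omega>'))"
  have z: "continuous_on UNIV z"
    unfolding z_def
    by (rule adm[unfolded admissible_paths_def, THEN conjunct2, THEN conjunct2, THEN conjunct2,
        THEN bspec, OF \<open>\<omega>' \<in> \<Omega>\<close>, THEN conjunct1])
  have "bounded (z ` {0..t})"
    by (intro compact_imp_bounded compact_continuous_image continuous_on_subset[OF z]) auto
  then obtain Z where "Z > 0" and Z: "\<And>s. s \<in> {0..t} \<Longrightarrow> \<bar>z s\<bar> \<le> Z"
    unfolding bounded_pos by auto
  have "eventually (\<lambda>\<epsilon>. 0 < \<epsilon> \<and> \<epsilon> \<le> b \<and> \<epsilon> * Z \<le> d) (at_right 0)"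
    using \<open>b > 0\<close> \<open>d > 0\<close> \<open>Z > 0\<close>
    by (intro eventually_at_right_0I[of "min b (d / Z)"]) (auto simp: less_divide_eq)
  moreover have "eventually (\<lambda>\<epsilon>. A\<epsilon> \<epsilon> \<omega>' \<subseteq> cball 0 absorbing_radius) (at_right 0)"
    by (rule random_attractor_in_ball[OF adm \<open>\<omega>' \<in> \<Omega>\<close> \<open>b > 0\<close> attr])
  ultimately show "eventually (\<lambda>\<epsilon>. semidist (A\<epsilon> \<epsilon> \<omega>) A \<le> ennreal e) (at_right 0)"
  proof eventually_elim
    case (elim \<epsilon>)
    show ?case
    proof (rule semidist_le)
      fix x assume x: "x \<in> A\<epsilon> \<epsilon> \<omega>"
      have "lattice_cocycle \<alpha> \<beta> \<nu> lam \<gamma> f ix \<epsilon> t \<omega>' ` A\<epsilon> \<epsilon> \<omega>' = A\<epsilon> \<epsilon> (shift t \<omega>')"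
        using attr[of \<epsilon>] elim \<open>\<omega>' \<in> \<Omega>\<close> \<open>t \<ge> 0\<close> unfolding random_attractor_def by blast
      then obtain x' where x': "x' \<in> A\<epsilon> \<epsilon> \<omega>'" "x = flow (\<lambda>s. \<epsilon> * z s) t x'"
        using x unfolding shift_\<omega>' lattice_cocycle_flow z_def by blast
      have "\<bar>\<epsilon> * z s\<bar> \<le> d" if "s \<in> {0..t}" for s
      proof -
        have "\<bar>\<epsilon> * z s\<bar> \<le> \<epsilon> * Z"
          using Z[OF that] elim by (simp add: abs_mult)
        then show ?thesis using elim by linarith
      qed
      moreover have "continuous_on {0..} (\<lambda>s. \<epsilon> * z s)"
        by (intro continuous_intros continuous_on_subset[OF z]) simp
      moreover have "x' \<in> cball 0 absorbing_radius"
        using x' elim by blast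
      ultimately have "norm (x - flow (\<lambda>_. 0) t x') \<le> e / 2"
        unfolding x'(2) using d by blast
      moreover obtain a where "a \<in> A" "dist (flow (\<lambda>_. 0) t x') a < e / 2"
        using t \<open>x' \<in> cball 0 absorbing_radius\<close> by blast
      ultimately have "dist x a \<le> e"
        using dist_triangle[of x a "flow (\<lambda>_. 0) t x'"] unfolding dist_norm by linarith
      with \<open>a \<in> A\<close> show "\<exists>a\<in>A. dist x a \<le> e" by blast
    qed
  qed
qed

end

text \<open>This makes the admissible range of \<epsilon> a right neighbourhood of \<open>0\<close>.
  The denominator \<open>M_const\<close> is positive because its linear term is, at a radius above
  \<open>0\<close>.\<close>

lemma eps_star_pos:
  assumes "\<alpha> > 0" "\<beta> > 0" "\<nu> > 0" "lam > 0" "0 < \<gamma>" "lam > lam_star \<alpha> \<beta> \<nu> \<gamma>"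
  shows "eps_star \<alpha> \<beta> \<nu> lam \<gamma> f > 0"
proof -
  define r where "r = r_star \<alpha> \<beta> \<nu> lam \<gamma> f + 1"
  have f: "l2_norm f \<ge> 0"
    unfolding l2_norm_def by (intro real_sqrt_ge_zero infsum_nonneg) auto
  then have "l2_norm f / (lam - lam_star \<alpha> \<beta> \<nu> \<gamma>) \<ge> 0"
    using assms by simp
  then have "r > 0"
    unfolding r_def r_star_def by linarith
  then have "(4 * \<nu> + \<beta> * \<gamma> + lam) * r > 0"
    using assms by (intro mult_pos_pos add_pos_pos) auto
  moreover have "\<beta> * r ^ 3 \<ge> 0" "(2 * \<alpha> + \<beta> + \<beta> * \<gamma>) * r\<^sup>2 \<ge> 0"
    using \<open>r > 0\<close> assms by auto
  ultimately have "M_const \<alpha> \<beta> \<nu> lam \<gamma> f r > 0"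
    using f unfolding M_const_def by linarith
  moreover have "L_const \<alpha> \<beta> \<nu> lam \<gamma> r > 0"
    unfolding L_const_def using \<open>r > 0\<close> assms
    by (intro add_nonneg_pos add_nonneg_nonneg mult_nonneg_nonneg real_sqrt_ge_zero) auto
  ultimately show ?thesis
    by (simp add: eps_star_def r_def)
qed

theorem theorem5p3:
  fixes \<alpha> \<beta> \<nu> lam \<gamma> :: real
    and f :: "int \<Rightarrow> real"
    and m :: nat
    and ix :: "'n::finite \<Rightarrow> int"
    and P :: "(real \<Rightarrow> real) measure"
    and \<Omega> :: "(real \<Rightarrow> real) set"
  assumes "\<alpha> > 0" "\<beta> > 0" "\<nu> > 0" "lam > 0" "0 < \<gamma>" "\<gamma> < 1"
    and "(\<lambda>i. (f i)\<^sup>2) summable_on UNIV"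
    and "lam > lam_star \<alpha> \<beta> \<nu> \<gamma>"
    and "bij_betw ix UNIV {- int m..int m}"
    and "two_sided_wiener P"
    and "admissible_paths P \<Omega>"
  shows "\<exists>A :: (real ^ 'n) set.
           global_attractor (lattice_semigroup \<alpha> \<beta> \<nu> lam \<gamma> f ix) A \<and>
           (\<forall>A\<epsilon> :: real \<Rightarrow> (real \<Rightarrow> real) \<Rightarrow> (real ^ 'n) set.
              (\<forall>\<epsilon>\<in>{0<..eps_star \<alpha> \<beta> \<nu> lam \<gamma> f}.
                 random_attractor P \<Omega> (lattice_cocycle \<alpha> \<beta> \<nu> lam \<gamma> f ix \<epsilon>) (A\<epsilon> \<epsilon>)) \<longrightarrow>
              (\<forall>\<omega>\<in>\<Omega>. ((\<lambda>\<epsilon>. semidist (A\<epsilon> \<epsilon> \<omega>) A) \<longlongrightarrow> 0) (at_right 0)))"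
proof -
  interpret lattice_model \<alpha> \<beta> \<nu> lam \<gamma> f ix
    using assms by unfold_locales (auto simp: bij_betw_def)
  \<comment> \<open>The uniform estimate \<open>near\<close> comes with the same witness, so one set
    serves both conjuncts.\<close>
  obtain A where "global_attractor (lattice_semigroup \<alpha> \<beta> \<nu> lam \<gamma> f ix) A"
    and near: "\<And>e. e > 0 \<Longrightarrow> \<exists>t\<ge>0. \<forall>x\<in>cball 0 absorbing_radius. \<exists>a\<in>A. dist (flow (\<lambda>_. 0) t x) a < e"
    using lattice_semigroup_attractor by blast
  moreover have "eps_star \<alpha> \<beta> \<nu> lam \<gamma> f > 0"
    using assms by (intro eps_star_pos)
  ultimately show ?thesis
    using random_attractor_upper_semicontinuous[OF assms(11) _ _ _ near] by (intro exI[of _ A]) auto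
qed

end
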